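(* Let $(E,\mathcal E)$ be a measurable space and let $\bar{\mathbb P}=(\bar{\mathbb P}_x(1,dy))_{x\in E}$ be a fixed homogeneous (linear) Markov transition kernel on $(E,\mathcal E)$, with associated operator $\bar V$ (defined in the context) having spectral radius $r(\bar V)$. Consider families of transition kernels $(\mathbb P_\mu(x,dy))_{x\in E,\ \mu\in\mathcal P(E)}$ (defining nonlinear Markov chains) satisfying, with constants $\gamma>0$ and $\lambda_k<\infty$, $k\ge 1$: (i) for all $x\in E$ and $\mu\in\mathcal P(E)$ the measures $\bar{\mathbb P}_x(1,\cdot)$ and $\mathbb P_\mu(x,\cdot)$ are mutually absolutely continuous and $$\frac{\bar{\mathbb P}_x(1,dy)}{\mathbb P_\mu(x,dy)}\le 1+\gamma\qquad\text{for all } x,y\in E,\ \mu\in\mathcal P(E);$$ (ii) for every $k\ge1$, $$\|\mathbb P^{(k)}_\mu(x,\cdot)-\mathbb P^{(k)}_\nu(x,\cdot)\|_{TV}\le\lambda_k\|\mu-\nu\|_{TV}\qquad\text{for all } x\in E,\ \mu,\nu\in\mathcal P(E).$$ Then for any initial distributions $\mu_0,\nu_0\in\mathcal P(E)$, $$\limsup_{\gamma,\lambda_1\to0}\ \limsup_{n\to\infty}\ \frac1n\ln\|\mu_n-\nu_n\|_{TV}\le\ln r(\bar V).$$ That is, along any sequence of such families of kernels (with $\bar{\mathbb P}$ fixed) whose constants $\gamma$ and $\lambda_1$ tend to $0$, the upper limit of the quantities $\limsup_{n\to\infty}\frac1n\ln\|\mu_n-\nu_n\|_{TV}$ is at most $\ln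 r(\bar V)$ (with the convention $\ln0=-\infty$).
   Context: $\mathcal P(E)$ is the set of probability measures on $(E,\mathcal E)$. The total variation distance is normalised as $\|\mu-\nu\|_{TV}=2\sup_{A}(\mu(A)-\nu(A))$. Nonlinear Markov chain: for a family of transition kernels $\mathbb P_\mu(x,dy)$ depending on $\mu\in\mathcal P(E)$, the chain with initial law $\mu_0$ satisfies $\mathbb P(X_{n+1}\in B\mid X_n=x;\ \mathrm{Law}(X_n)=\mu_n)=\mathbb P_{\mu_n}(x,B)$. Its marginal laws are given recursively by $\mu_{n+1}=\mu_n\mathbb P_{\mu_n}$, i.e. $\mu_{n+1}(B)=\int\mu_n(dx)\,\mathbb P_{\mu_n}(x,B)$. The sequence $\nu_n$ is defined in the same way from $\nu_0$, with the same family of kernels. $k$-step kernels: for $\mu\in\mathcal P(E)$ put $\mu_0=\mu$, $\mu_k=\mu_{k-1}\mathbb P_{\mu_{k-1}}$, $\mathbb P^{(0)}_\mu(x,\cdot)=\delta_x$, and $\mathbb P^{(k)}_\mu(x,\cdot)=\delta_x\mathbb P^{(k-1)}_\mu\mathbb P_{\mu_{k-1}}$ for $k\ge1$; that is, $\mathbb P_\mu^{(k)}(x,\cdot)=\delta_x\mathbb P_{\mu_0}\mathbb P_{\mu_1}\cdots\mathbb P_{\mu_{k-1}}$. The operator $\bar V$: for $x^1,x^2\in E$ let $\bar p(x^i,\cdot)$, $i=1,2$, be the densities of $\bar{\mathbb P}_{x^i}(1,\cdot)$ with respect to a common dominating measure $\Lambda$ (the objects below do not depend on its choice). Put $$\bar\kappa(x^1,x^2)=\int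 \bar p(x^1,u)\wedge\bar p(x^2,u)\,\Lambda(du)=\int\Big(\frac{\bar{\mathbb P}_{x^1}(1,dy)}{\bar{\mathbb P}_{x^2}(1,dy)}\wedge1\Big)\bar{\mathbb P}_{x^2}(1,dy)$$ and, when $\bar\kappa(x^1,x^2)<1$, $$\bar\phi_i(x^1,x^2;u)=\frac{\bar p(x^i,u)-\bar p(x^1,u)\wedge\bar p(x^2,u)}{1-\bar\kappa(x^1,x^2)},\qquad i=1,2 .$$ For bounded measurable $h:E\times E\to\mathbb R$, $$\bar Vh(x^1,x^2)=(1-\bar\kappa(x^1,x^2))\iint h(u^1,u^2)\,\bar\phi_1(x^1,x^2;u^1)\,\bar\phi_2(x^1,x^2;u^2)\,\Lambda(du^1)\Lambda(du^2),$$ and $\bar Vh(x^1,x^2)=0$ when $\bar\kappa(x^1,x^2)=1$. The operator $\bar V$ is a non-negative bounded linear operator on the space of bounded measurable functions on $E\times E$ with the sup-norm (measurability of these expressions in $(x^1,x^2)$ is tacitly assumed), and $r(\bar V)$ denotes its spectral radius. *)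

theory Defs
  imports "HOL-Probability.Probability"
begin

section \<open>Total variation and nonlinear Markov chains\<close>

text \<open>
  Throughout, the measurable space of states is given by \<open>M\<close>, of which only the carrier and the
  sigma-algebra matter.  The set of probability measures on it is \<open>space (prob_algebra M)\<close>, and
  \<open>K \<in> M \<rightarrow>\<^sub>M prob_algebra M\<close> says that \<open>K\<close> is a transition kernel.
\<close>

definition tv :: "'a measure \<Rightarrow> 'a measure \<Rightarrow> real" where
  "tv \<mu> \<nu> = 2 * (SUP A\<in>sets \<mu>. measure \<mu> A - measure \<nu> A)"

primrec law :: "('a measure \<Rightarrow> 'a \<Rightarrow> 'a measure) \<Rightarrow> 'a measure \<Rightarrow> nat \<Rightarrow> 'a measure" where
  "law P \<mu> 0 = \<mu>"
| "law P \<mu> (Suc n) = law P \<mu> n \<bind> P (law P \<mu> n)"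

primrec kernel_step ::
  "'a measure \<Rightarrow> ('a measure \<Rightarrow> 'a \<Rightarrow> 'a measure) \<Rightarrow> nat \<Rightarrow> 'a measure \<Rightarrow> 'a \<Rightarrow> 'a measure" where
  "kernel_step M P 0 \<mu> x = return M x"
| "kernel_step M P (Suc k) \<mu> x = kernel_step M P k \<mu> x \<bind> P (law P \<mu> k)"

definition eln :: "real \<Rightarrow> ereal" where
  "eln t = (if t \<le> 0 then -\<infinity> else ereal (ln t))"


section \<open>The operator of a kernel\<close>

text \<open>
  In the next three definitions \<open>p1\<close> and \<open>p2\<close> are densities of two probability measures with
  respect to the dominating measure \<open>\<Lambda>\<close>.  The function \<open>h\<close> may take real or complex values; for
  complex values the last expression is the complexification of the one for real values.
\<close>

definition overlap :: "'a measure \<Rightarrow> ('a \<Rightarrow> real) \<Rightarrow> ('a \<Rightarrow> real) \<Rightarrow> real" where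
  "overlap \<Lambda> p1 p2 = (\<integral>u. min (p1 u) (p2 u) \<partial>\<Lambda>)"

definition excess :: "'a measure \<Rightarrow> ('a \<Rightarrow> real) \<Rightarrow> ('a \<Rightarrow> real) \<Rightarrow> ('a \<Rightarrow> real) \<Rightarrow> 'a \<Rightarrow> real" where
  "excess \<Lambda> p1 p2 p u = (p u - min (p1 u) (p2 u)) / (1 - overlap \<Lambda> p1 p2)"

definition excess_integral ::
  "'a measure \<Rightarrow> ('a \<Rightarrow> real) \<Rightarrow> ('a \<Rightarrow> real) \<Rightarrow> ('a \<times> 'a \<Rightarrow> 'b) \<Rightarrow>
    'b::{banach, second_countable_topology}" where
  "excess_integral \<Lambda> p1 p2 h =
    (if overlap \<Lambda> p1 p2 = 1 then 0
     else (1 - overlap \<Lambda> p1 p2) *\<^sub>R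
       (\<integral>u1. (\<integral>u2. (excess \<Lambda> p1 p2 p1 u1 * excess \<Lambda> p1 p2 p2 u2) *\<^sub>R h (u1, u2) \<partial>\<Lambda>) \<partial>\<Lambda>))"

text \<open>
  As dominating measure we take the sum of the two measures; the lemma \<open>V_op_eq\<close> below shows that
  any other choice of a dominating measure and of versions of the densities gives the same operator.
\<close>

definition sum_measure :: "'a measure \<Rightarrow> 'a measure \<Rightarrow> 'a measure" where
  "sum_measure \<mu> \<nu> = measure_of (space \<mu>) (sets \<mu>) (\<lambda>A. emeasure \<mu> A + emeasure \<nu> A)"

definition dens :: "'a measure \<Rightarrow> 'a measure \<Rightarrow> 'a \<Rightarrow> real" where
  "dens \<Lambda> \<mu> u = enn2real (RN_deriv \<Lambda> \<mu> u)"

text \<open>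
  Functions on the state space are represented by HOL functions that vanish outside the carrier,
  so that equality of functions is HOL equality.
\<close>

definition V_op ::
  "'a measure \<Rightarrow> ('a \<Rightarrow> 'a measure) \<Rightarrow> ('a \<times> 'a \<Rightarrow> 'b) \<Rightarrow> 'a \<times> 'a \<Rightarrow>
    'b::{banach, second_countable_topology}" where
  "V_op M K h z =
    (if z \<in> space (M \<Otimes>\<^sub>M M)
     then let \<mu>1 = K (fst z); \<mu>2 = K (snd z); \<Lambda> = sum_measure \<mu>1 \<mu>2
          in excess_integral \<Lambda> (dens \<Lambda> \<mu>1) (dens \<Lambda> \<mu>2) h
     else 0)"


section \<open>Spectral radius\<close>

text \<open>
  As usual, the spectrum of an operator on the real space of bounded measurable functions is that of
  its complexification, which acts on the bounded measurable functions with complex values.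
\<close>

definition bdd_measurable :: "'a measure \<Rightarrow> ('a \<Rightarrow> complex) set" where
  "bdd_measurable N = {h \<in> borel_measurable N. bounded (range h) \<and> (\<forall>z. z \<notin> space N \<longrightarrow> h z = 0)}"

definition sup_norm :: "'a measure \<Rightarrow> ('a \<Rightarrow> complex) \<Rightarrow> real" where
  "sup_norm N h = (SUP z\<in>space N. cmod (h z))"

definition resolvent_set :: "'a measure \<Rightarrow> (('a \<Rightarrow> complex) \<Rightarrow> ('a \<Rightarrow> complex)) \<Rightarrow> complex set" where
  "resolvent_set N T =
    {c. bij_betw (\<lambda>h z. c * h z - T h z) (bdd_measurable N) (bdd_measurable N) \<and>
        (\<exists>C. \<forall>h\<in>bdd_measurable N. sup_norm N h \<le> C * sup_norm N (\<lambda>z. c * h z - T h z))}"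

definition spectrum :: "'a measure \<Rightarrow> (('a \<Rightarrow> complex) \<Rightarrow> ('a \<Rightarrow> complex)) \<Rightarrow> complex set" where
  "spectrum N T = - resolvent_set N T"

definition spectral_radius :: "'a measure \<Rightarrow> (('a \<Rightarrow> complex) \<Rightarrow> ('a \<Rightarrow> complex)) \<Rightarrow> real" where
  "spectral_radius N T = (SUP c\<in>spectrum N T. cmod c)"


section \<open>Independence of the dominating measure\<close>

lemma sets_sum_measure [simp, measurable_cong]: "sets (sum_measure \<mu> \<nu>) = sets \<mu>"
  and space_sum_measure [simp]: "space (sum_measure \<mu> \<nu>) = space \<mu>"
  by (simp_all add: sum_measure_def)

lemma measurable_dens [measurable]: "dens \<Lambda> \<mu> \<in> borel_measurable \<Lambda>"
  unfolding dens_def by measurable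

lemma emeasure_sum_measure:
  assumes "sets \<nu> = sets \<mu>" "A \<in> sets \<mu>"
  shows "emeasure (sum_measure \<mu> \<nu>) A = emeasure \<mu> A + emeasure \<nu> A"
  unfolding sum_measure_def
proof (rule emeasure_measure_of_sigma)
  show "countably_additive (sets \<mu>) (\<lambda>A. emeasure \<mu> A + emeasure \<nu> A)"
    unfolding countably_additive_def
  proof (intro allI impI)
    fix A :: "nat \<Rightarrow> _"
    assume A: "range A \<subseteq> sets \<mu>" "disjoint_family A"
    have "(\<Sum>i. emeasure \<mu> (A i)) = emeasure \<mu> (\<Union> (range A))"
      "(\<Sum>i. emeasure \<nu> (A i)) = emeasure \<nu> (\<Union> (range A))"
      using A assms(1) by (auto intro!: suminf_emeasure)
    then show "(\<Sum>i. emeasure \<mu> (A i) + emeasure \<nu> (A i))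
        = emeasure \<mu> (\<Union> (range A)) + emeasure \<nu> (\<Union> (range A))"
      by (simp add: suminf_add[symmetric])
  qed
qed (use assms in \<open>auto simp: positive_def sets.sigma_algebra_axioms\<close>)

lemma finite_sum_measure:
  assumes "finite_measure \<mu>" "finite_measure \<nu>" "sets \<nu> = sets \<mu>"
  shows "finite_measure (sum_measure \<mu> \<nu>)"
proof
  have "space \<nu> = space \<mu>" using assms(3) by (rule sets_eq_imp_space_eq)
  then show "emeasure (sum_measure \<mu> \<nu>) (space (sum_measure \<mu> \<nu>)) \<noteq> \<infinity>"
    using finite_measure.emeasure_finite[OF assms(1)] finite_measure.emeasure_finite[OF assms(2)]
    by (simp add: emeasure_sum_measure[OF assms(3)])
qed

lemma density_dens_sum_measure:
  assumes "finite_measure \<mu>" "finite_measure \<nu>" "sets \<nu> = sets \<mu>" "\<rho> = \<mu> \<or> \<rho> = \<nu>"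
  shows "density (sum_measure \<mu> \<nu>) (dens (sum_measure \<mu> \<nu>) \<rho>) = \<rho>"
proof -
  let ?L = "sum_measure \<mu> \<nu>"
  interpret finite_measure ?L by (rule finite_sum_measure) fact+
  have ac: "absolutely_continuous ?L \<rho>"
    using assms(3,4) unfolding absolutely_continuous_def
    by (auto simp: null_sets_def emeasure_sum_measure)
  have sets: "sets \<rho> = sets ?L" using assms by auto
  have "sigma_finite_measure \<rho>"
    using assms by (auto intro: finite_measure.axioms)
  from RN_deriv_finite[OF this ac sets]
  have "AE u in ?L. ennreal (dens ?L \<rho> u) = RN_deriv ?L \<rho> u"
    by eventually_elim (simp add: dens_def less_top)
  then have "density ?L (dens ?L \<rho>) = density ?L (RN_deriv ?L \<rho>)"
    by (intro density_cong) (auto simp: dens_def)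
  then show ?thesis using density_RN_deriv[OF ac sets] by simp
qed

lemma excess_integral_eq:
  fixes h :: "'a \<times> 'a \<Rightarrow> 'b::{banach, second_countable_topology}"
  assumes \<mu>: "finite_measure \<mu>" "sets \<mu> = sets M" and \<nu>: "finite_measure \<nu>" "sets \<nu> = sets M"
    and p [measurable]: "p1 \<in> borel_measurable \<Lambda>" "p2 \<in> borel_measurable \<Lambda>"
    and nonneg: "\<And>u. 0 \<le> p1 u" "\<And>u. 0 \<le> p2 u"
    and dens: "density \<Lambda> p1 = \<mu>" "density \<Lambda> p2 = \<nu>"
    and h: "h \<in> borel_measurable (M \<Otimes>\<^sub>M M)"
  shows "overlap (sum_measure \<mu> \<nu>) (dens (sum_measure \<mu> \<nu>) \<mu>) (dens (sum_measure \<mu> \<nu>) \<nu>)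
      = overlap \<Lambda> p1 p2" (is ?overlap)
    and "excess_integral (sum_measure \<mu> \<nu>) (dens (sum_measure \<mu> \<nu>) \<mu>) (dens (sum_measure \<mu> \<nu>) \<nu>) h
      = excess_integral \<Lambda> p1 p2 h" (is ?int)
proof -
  define L where "L = sum_measure \<mu> \<nu>"
  define q1 where "q1 = dens L \<mu>"
  define q2 where "q2 = dens L \<nu>"
  define w where "w u = p1 u + p2 u" for u
  have sets_\<Lambda> [measurable_cong]: "sets \<Lambda> = sets M" using dens(1) \<mu>(2) by (metis sets_density)
  have [measurable_cong]: "sets L = sets M" by (simp add: L_def \<mu>)
  have sets_\<nu>\<mu>: "sets \<nu> = sets \<mu>" using \<mu> \<nu> by simp
  interpret L: finite_measure L unfolding L_def by (rule finite_sum_measure) (use \<mu> \<nu> in auto)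
  have [measurable]: "q1 \<in> borel_measurable L" "q2 \<in> borel_measurable L"
    by (simp_all add: q1_def q2_def)
  have [measurable]: "p1 \<in> borel_measurable M" "p2 \<in> borel_measurable M"
    "q1 \<in> borel_measurable M" "q2 \<in> borel_measurable M" "w \<in> borel_measurable M"
    unfolding w_def by measurable
  note [measurable] = h
  have q0: "0 \<le> q1 u" "0 \<le> q2 u" for u by (simp_all add: q1_def q2_def dens_def)
  have w0: "0 \<le> w u" for u using nonneg by (simp add: w_def)
  have L: "L = density \<Lambda> w"
  proof (rule measure_eqI)
    fix A assume A: "A \<in> sets L"
    then have A': "A \<in> sets \<mu>" "A \<in> sets \<Lambda>" using sets_\<Lambda> \<mu> by (auto simp: L_def)
    have "emeasure L A = emeasure (density \<Lambda> p1) A + emeasure (density \<Lambda> p2) A"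
      using A' sets_\<nu>\<mu> by (simp add: L_def emeasure_sum_measure dens)
    also have "\<dots> = emeasure (density \<Lambda> (\<lambda>u. ennreal (p1 u) + ennreal (p2 u))) A"
      using A' by (intro emeasure_density_add) auto
    finally show "emeasure L A = emeasure (density \<Lambda> w) A"
      using nonneg by (simp add: w_def)
  qed (use sets_\<Lambda> \<mu> in \<open>simp add: L_def\<close>)
  have dq: "density L q1 = \<mu>" "density L q2 = \<nu>"
    unfolding L_def q1_def q2_def
    by (intro density_dens_sum_measure; use \<mu> \<nu> in simp)+
  have key: "AE u in \<Lambda>. p u = w u * q u"
    if "density L q = \<rho>" "density \<Lambda> p = \<rho>" "finite_measure \<rho>"
      and [measurable]: "q \<in> borel_measurable M" "p \<in> borel_measurable M"
      and "\<And>u. 0 \<le> q u" "\<And>u. 0 \<le> p u" for p q :: "'a \<Rightarrow> real" and \<rho>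
  proof -
    have "density \<Lambda> (\<lambda>u. ennreal (w u * q u)) = density \<Lambda> p"
      using that(1,2) w0 that(6) unfolding L by (simp add: density_density_eq ennreal_mult)
    moreover have "sigma_finite_measure (density \<Lambda> p)"
      unfolding that(2) using that(3) by (rule finite_measure.axioms)
    ultimately have "AE u in \<Lambda>. ennreal (p u) = ennreal (w u * q u)"
      by (subst sigma_finite_density_unique[symmetric]) simp_all
    then show ?thesis
      by eventually_elim (use that(6,7) w0 in simp)
  qed
  have k1: "AE u in \<Lambda>. p1 u = w u * q1 u" by (rule key[OF dq(1) dens(1) \<mu>(1)]) (use q0 nonneg in auto)
  have k2: "AE u in \<Lambda>. p2 u = w u * q2 u" by (rule key[OF dq(2) dens(2) \<nu>(1)]) (use q0 nonneg in auto)
  have mn: "min (w u * a) (w u * b) = w u * min a b" for u a b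
    using w0[of u] by (simp add: min_mult_distrib_left)
  have "overlap L q1 q2 = (\<integral>u. w u * min (q1 u) (q2 u) \<partial>\<Lambda>)"
    unfolding overlap_def L by (subst integral_density) (use w0 in auto)
  also have "\<dots> = overlap \<Lambda> p1 p2"
    unfolding overlap_def
  proof (rule integral_cong_AE)
    show "AE u in \<Lambda>. w u * min (q1 u) (q2 u) = min (p1 u) (p2 u)"
      using k1 k2 by eventually_elim (simp add: mn)
  qed measurable
  finally have ov: "overlap L q1 q2 = overlap \<Lambda> p1 p2" .
  then show ?overlap by (simp add: L_def q1_def q2_def)
  define e1 where "e1 = excess L q1 q2 q1"
  define e2 where "e2 = excess L q1 q2 q2"
  define f1 where "f1 = excess \<Lambda> p1 p2 p1"
  define f2 where "f2 = excess \<Lambda> p1 p2 p2"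
  have [measurable]: "e1 \<in> borel_measurable M" "e2 \<in> borel_measurable M"
    "f1 \<in> borel_measurable M" "f2 \<in> borel_measurable M"
    unfolding e1_def e2_def f1_def f2_def excess_def by measurable
  have f1: "AE u in \<Lambda>. f1 u = w u * e1 u"
    using k1 k2 by eventually_elim
      (simp add: f1_def e1_def excess_def ov mn right_diff_distrib)
  have f2: "AE u in \<Lambda>. f2 u = w u * e2 u"
    using k1 k2 by eventually_elim
      (simp add: f2_def e2_def excess_def ov mn right_diff_distrib)
  have sp: "space \<Lambda> = space M" using sets_\<Lambda> by (rule sets_eq_imp_space_eq)
  have meas: "(\<lambda>u1. \<integral>u2. e2 u2 *\<^sub>R h (u1, u2) \<partial>L) \<in> borel_measurable M"
    by measurable
  have pull: "(\<integral>u2. (a * g u2) *\<^sub>R h (u1, u2) \<partial>N) = a *\<^sub>R (\<integral>u2. g u2 *\<^sub>R h (u1, u2) \<partial>N)"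
    for a u1 and g :: "'a \<Rightarrow> real" and N
    by (simp flip: scaleR_scaleR)
  have inner': "w u1 *\<^sub>R (\<integral>u2. (e1 u1 * e2 u2) *\<^sub>R h (u1, u2) \<partial>L)
      = (w u1 * e1 u1) *\<^sub>R (\<integral>u2. e2 u2 *\<^sub>R h (u1, u2) \<partial>L)" for u1
    by (simp add: pull)
  have in2: "(\<integral>u2. e2 u2 *\<^sub>R h (u1, u2) \<partial>L) = (\<integral>u2. f2 u2 *\<^sub>R h (u1, u2) \<partial>\<Lambda>)"
    if "u1 \<in> space \<Lambda>" for u1
  proof -
    have [measurable]: "u1 \<in> space M" using that sp by simp
    have "(\<integral>u2. e2 u2 *\<^sub>R h (u1, u2) \<partial>L) = (\<integral>u2. w u2 *\<^sub>R e2 u2 *\<^sub>R h (u1, u2) \<partial>\<Lambda>)"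
      unfolding L by (subst integral_density) (use w0 in auto)
    also have "\<dots> = (\<integral>u2. f2 u2 *\<^sub>R h (u1, u2) \<partial>\<Lambda>)"
    proof (rule integral_cong_AE)
      show "AE u2 in \<Lambda>. w u2 *\<^sub>R e2 u2 *\<^sub>R h (u1, u2) = f2 u2 *\<^sub>R h (u1, u2)"
        using f2 by eventually_elim simp
    qed measurable
    finally show ?thesis .
  qed
  have "(\<integral>u1. (\<integral>u2. (e1 u1 * e2 u2) *\<^sub>R h (u1, u2) \<partial>L) \<partial>L)
      = (\<integral>u1. w u1 *\<^sub>R (\<integral>u2. (e1 u1 * e2 u2) *\<^sub>R h (u1, u2) \<partial>L) \<partial>\<Lambda>)"
    by (subst (1) L, subst integral_density) (use w0 in auto)
  also have "\<dots> = (\<integral>u1. (w u1 * e1 u1) *\<^sub>R (\<integral>u2. e2 u2 *\<^sub>R h (u1, u2) \<partial>L) \<partial>\<Lambda>)"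
    by (simp add: inner')
  also have "\<dots> = (\<integral>u1. f1 u1 *\<^sub>R (\<integral>u2. e2 u2 *\<^sub>R h (u1, u2) \<partial>L) \<partial>\<Lambda>)"
  proof (rule integral_cong_AE)
    show "AE u1 in \<Lambda>. (w u1 * e1 u1) *\<^sub>R (\<integral>u2. e2 u2 *\<^sub>R h (u1, u2) \<partial>L)
        = f1 u1 *\<^sub>R (\<integral>u2. e2 u2 *\<^sub>R h (u1, u2) \<partial>L)"
      using f1 by eventually_elim simp
  qed (use meas in measurable)
  also have "\<dots> = (\<integral>u1. f1 u1 *\<^sub>R (\<integral>u2. f2 u2 *\<^sub>R h (u1, u2) \<partial>\<Lambda>) \<partial>\<Lambda>)"
    by (rule Bochner_Integration.integral_cong) (simp_all add: in2)
  also have "\<dots> = (\<integral>u1. (\<integral>u2. (f1 u1 * f2 u2) *\<^sub>R h (u1, u2) \<partial>\<Lambda>) \<partial>\<Lambda>)"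
    by (simp add: pull)
  finally have "excess_integral L q1 q2 h = excess_integral \<Lambda> p1 p2 h"
    by (simp add: excess_integral_def ov e1_def e2_def f1_def f2_def)
  then show ?int by (simp add: L_def q1_def q2_def)
qed

lemma V_op_eq:
  assumes K: "K \<in> M \<rightarrow>\<^sub>M prob_algebra M" and x: "x1 \<in> space M" "x2 \<in> space M"
    and "p1 \<in> borel_measurable \<Lambda>" "p2 \<in> borel_measurable \<Lambda>"
    and "\<And>u. 0 \<le> p1 u" "\<And>u. 0 \<le> p2 u"
    and "density \<Lambda> p1 = K x1" "density \<Lambda> p2 = K x2"
    and "h \<in> borel_measurable (M \<Otimes>\<^sub>M M)"
  shows "V_op M K h (x1, x2) = excess_integral \<Lambda> p1 p2 h"
proof -
  have "prob_space (K x1)" "prob_space (K x2)" "sets (K x1) = sets M" "sets (K x2) = sets M"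
    using measurable_space[OF K] x by (auto simp: space_prob_algebra)
  then have "excess_integral (sum_measure (K x1) (K x2)) (dens (sum_measure (K x1) (K x2)) (K x1))
      (dens (sum_measure (K x1) (K x2)) (K x2)) h = excess_integral \<Lambda> p1 p2 h"
    using assms by (intro excess_integral_eq(2)[where M = M]) (auto intro: prob_space.finite_measure)
  then show ?thesis using x by (simp add: V_op_def space_pair_measure)
qed

end

theory Submission
  imports Defs
begin

text \<open>
  Let \<open>D f (x, y) = f x - f y\<close>.  Since \<open>V\<close> integrates against the product of the two excess parts,
  \<open>D (K f) = V (D f)\<close>, so \<open>K^k f\<close> oscillates by at most \<open>sup V^k 1\<close> whenever \<open>0 \<le> f \<le> 1\<close>.
  Replacing the kernels of the nonlinear chains by \<open>K\<close> one step at a time costs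
  \<open>\<delta> = 2 \<gamma> + \<lambda>\<^sub>1\<close> times the current distance, whence
  \<open>tv \<mu>\<^sub>k \<nu>\<^sub>k \<le> (sup V^k 1 + (1 + \<delta>)^k - 1) tv \<mu>\<^sub>0 \<nu>\<^sub>0\<close>, and this can be iterated.

  It remains to see that \<open>sup V^k 1 < t^k\<close> for some \<open>k\<close> as soon as \<open>t\<close> exceeds the spectral radius.
  As \<open>V\<close> is positive this needs no complex analysis: \<open>\<rho> = inf (sup V^k 1)^(1/k)\<close> itself lies in the
  spectrum.  Otherwise the partial sums of \<open>\<Sum> V^k 1 / s^(k+1)\<close> would stay
  bounded as \<open>s\<close> decreases to \<open>\<rho>\<close>, so \<open>\<Sum> V^k 1 / \<rho>^(k+1)\<close> would be bounded, and the estimate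
  \<open>n V^n 1 \<le> \<Sum>k<n. sup V^(n-k) 1 * V^k 1\<close> would give \<open>sup V^n 1 < \<rho>^n\<close> for large \<open>n\<close>.
\<close>

section \<open>Total variation and integrals\<close>

lemma prob_algebraD:
  assumes "\<mu> \<in> space (prob_algebra M)"
  shows "prob_space \<mu>" "finite_measure \<mu>" "sets \<mu> = sets M" "space \<mu> = space M"
  using assms by (auto simp: space_prob_algebra prob_space.finite_measure dest: sets_eq_imp_space_eq)

lemma integrable_bounded_on:
  fixes f :: "'a \<Rightarrow> 'b::{banach, second_countable_topology}"
  assumes "finite_measure \<mu>" "sets \<mu> = sets M" "f \<in> borel_measurable M" "bounded (f ` space M)"
  shows "integrable \<mu> f"
proof -
  interpret finite_measure \<mu> by fact
  obtain B where "\<And>x. x \<in> space M \<Longrightarrow> norm (f x) \<le> B"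
    using assms(4) by (auto simp: bounded_iff)
  moreover have "f \<in> borel_measurable \<mu>"
    using assms(2,3) by (simp cong: measurable_cong_sets)
  ultimately show ?thesis
    using sets_eq_imp_space_eq[OF assms(2)] by (intro integrable_const_bound[of _ B]) auto
qed

text \<open>Among functions \<open>g = f - b\<close> with values in \<open>[0, c]\<close>, the
  integral of \<open>(p - q) * g\<close>, with \<open>p\<close> and \<open>q\<close> the densities
  of the two measures, is largest for \<open>g\<close> equal to \<open>c\<close> on
  \<open>{q < p}\<close> and 0 elsewhere. There it is \<open>c\<close> times a difference of
  probabilities. The factor 1/2 undoes the 2 in \<open>tv\<close>.\<close>

lemma integral_diff_le_tv:
  fixes f :: "'a \<Rightarrow> real"
  assumes \<mu>: "\<mu> \<in> space (prob_algebra M)" and \<nu>: "\<nu> \<in> space (prob_algebra M)"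
    and f [measurable]: "f \<in> borel_measurable M"
    and f_bounds: "\<And>x. x \<in> space M \<Longrightarrow> b \<le> f x" "\<And>x. x \<in> space M \<Longrightarrow> f x \<le> b + c"
  shows "(\<integral>x. f x \<partial>\<mu>) - (\<integral>x. f x \<partial>\<nu>) \<le> c * (tv \<mu> \<nu> / 2)"
proof -
  note m = prob_algebraD[OF \<mu>] and n = prob_algebraD[OF \<nu>]
  interpret \<mu>: prob_space \<mu> by (rule m)
  interpret \<nu>: prob_space \<nu> by (rule n)
  define L where "L = sum_measure \<mu> \<nu>"
  define p where "p = dens L \<mu>"
  define q where "q = dens L \<nu>"
  define A where "A = {u\<in>space M. q u < p u}"
  have sL [measurable_cong]: "sets L = sets M" and spL: "space L = space M"
    by (simp_all add: L_def m)
  have [measurable]: "p \<in> borel_measurable M" "q \<in> borel_measurable M"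
    unfolding p_def q_def by measurable
  have pq0: "0 \<le> p u" "0 \<le> q u" for u by (simp_all add: p_def q_def dens_def)
  have d\<mu>: "density L p = \<mu>" and d\<nu>: "density L q = \<nu>"
    unfolding L_def p_def q_def using m n by (intro density_dens_sum_measure; simp)+
  have A [measurable]: "A \<in> sets M" unfolding A_def by measurable
  have "0 \<le> c"
    using f_bounds \<mu>.not_empty m(4) by (metis add_le_cancel_left add.right_neutral ex_in_conv order_trans)
  have bounded_f: "bounded (f ` space M)"
    using f_bounds by (intro boundedI[of _ "\<bar>b\<bar> + \<bar>c\<bar>"]) fastforce
  have int\<mu>: "integrable \<mu> g" and int\<nu>: "integrable \<nu> g"
    if "g \<in> borel_measurable M" "bounded (g ` space M)" for g :: "'a \<Rightarrow> real"
    using integrable_bounded_on[OF m(2,3) that] integrable_bounded_on[OF n(2,3) that] .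
  have i: "integrable L (\<lambda>u. p u * g u)" "integrable L (\<lambda>u. q u * g u)"
    "(\<integral>u. g u \<partial>\<mu>) = (\<integral>u. p u * g u \<partial>L)" "(\<integral>u. g u \<partial>\<nu>) = (\<integral>u. q u * g u \<partial>L)"
    if [measurable]: "g \<in> borel_measurable M" and b: "bounded (g ` space M)" for g :: "'a \<Rightarrow> real"
    using int\<mu>[OF that] int\<nu>[OF that] pq0
    unfolding d\<mu>[symmetric] d\<nu>[symmetric] by (simp_all add: integrable_density integral_density)
  let ?g = "\<lambda>u. f u - b" and ?h = "\<lambda>u. c * indicator A u"
  have bg: "bounded (?g ` space M)"
    using f_bounds by (intro boundedI[of _ "\<bar>c\<bar>"]) fastforce
  have bh: "bounded (?h ` space M)"
    by (intro boundedI[of _ "\<bar>c\<bar>"]) (auto simp: indicator_def)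
  have [measurable]: "?g \<in> borel_measurable M" "?h \<in> borel_measurable M" by measurable
  have "(\<integral>x. f x \<partial>\<mu>) - (\<integral>x. f x \<partial>\<nu>) = (\<integral>x. ?g x \<partial>\<mu>) - (\<integral>x. ?g x \<partial>\<nu>)"
    using int\<mu>[OF f bounded_f] int\<nu>[OF f bounded_f] by (simp add: \<mu>.prob_space \<nu>.prob_space)
  also have "\<dots> = (\<integral>u. p u * ?g u - q u * ?g u \<partial>L)"
    using i[OF _ bg] by simp
  also have "\<dots> \<le> (\<integral>u. p u * ?h u - q u * ?h u \<partial>L)"
  proof (rule integral_mono)
    fix u assume u: "u \<in> space L"
    then have g: "0 \<le> ?g u" "?g u \<le> c" using f_bounds spL by fastforce+
    show "p u * ?g u - q u * ?g u \<le> p u * ?h u - q u * ?h u"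
    proof (cases "q u < p u")
      case True
      then have "(p u - q u) * ?g u \<le> (p u - q u) * c" using g by (intro mult_left_mono) auto
      then show ?thesis using True u spL by (simp add: A_def algebra_simps)
    next
      case False
      then have "(p u - q u) * ?g u \<le> 0" using g by (intro mult_nonpos_nonneg) auto
      then show ?thesis using False by (simp add: A_def algebra_simps)
    qed
  qed (use i[OF _ bg] i[OF _ bh] in auto)
  also have "\<dots> = (\<integral>x. ?h x \<partial>\<mu>) - (\<integral>x. ?h x \<partial>\<nu>)"
    using i[OF _ bh] by simp
  also have "\<dots> = c * (measure \<mu> A - measure \<nu> A)"
    using A m n by (simp add: right_diff_distrib)
  also have "\<dots> \<le> c * (tv \<mu> \<nu> / 2)"
  proof -
    have "bdd_above ((\<lambda>A. measure \<mu> A - measure \<nu> A) ` sets \<mu>)"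
      by (intro bdd_aboveI2[of _ _ 1]) (smt (verit) \<mu>.prob_le_1 measure_nonneg)
    then have "measure \<mu> A - measure \<nu> A \<le> tv \<mu> \<nu> / 2"
      unfolding tv_def using A m(3) by (auto intro: cSUP_upper)
    then show ?thesis using \<open>0 \<le> c\<close> by (intro mult_left_mono)
  qed
  finally show ?thesis .
qed

text \<open>Indicators of measurable sets are among the admissible \<open>f\<close>. With
  \<open>integral_diff_le_tv\<close> for \<open>b = 0\<close> and \<open>c = 1\<close> as the
  converse, all later estimates of \<open>tv\<close> can be made on functions.\<close>

lemma tv_leI:
  assumes \<mu>: "\<mu> \<in> space (prob_algebra M)" and \<nu>: "\<nu> \<in> space (prob_algebra M)"
    and le: "\<And>f :: 'a \<Rightarrow> real. f \<in> borel_measurable M \<Longrightarrow> (\<And>x. x \<in> space M \<Longrightarrow> 0 \<le> f x \<and> f x \<le> 1)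
      \<Longrightarrow> (\<integral>x. f x \<partial>\<mu>) - (\<integral>x. f x \<partial>\<nu>) \<le> c"
  shows "tv \<mu> \<nu> \<le> 2 * c"
proof -
  note m = prob_algebraD[OF \<mu>] and n = prob_algebraD[OF \<nu>]
  have "(SUP A\<in>sets \<mu>. measure \<mu> A - measure \<nu> A) \<le> c"
  proof (rule cSUP_least)
    fix A assume A: "A \<in> sets \<mu>"
    then have "measure \<mu> A - measure \<nu> A = (\<integral>x. indicator A x \<partial>\<mu>) - (\<integral>x. indicator A x \<partial>\<nu>)"
      using m n by simp
    also have "\<dots> \<le> c" using A m by (intro le) (auto simp: indicator_def)
    finally show "measure \<mu> A - measure \<nu> A \<le> c" .
  qed (use sets.top in blast)
  then show ?thesis by (simp add: tv_def)
qed

lemma tv_nonneg: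
  assumes \<mu>: "\<mu> \<in> space (prob_algebra M)" and \<nu>: "\<nu> \<in> space (prob_algebra M)"
  shows "0 \<le> tv \<mu> \<nu>"
  using integral_diff_le_tv[OF assms, of "\<lambda>_. 0" 0 1] by simp

lemma tv_le_2:
  assumes \<mu>: "\<mu> \<in> space (prob_algebra M)" and \<nu>: "\<nu> \<in> space (prob_algebra M)"
  shows "tv \<mu> \<nu> \<le> 2"
proof -
  note m = prob_algebraD[OF \<mu>] and n = prob_algebraD[OF \<nu>]
  interpret \<mu>: prob_space \<mu> by (rule m)
  have "tv \<mu> \<nu> \<le> 2 * 1"
  proof (rule tv_leI[OF assms])
    fix f :: "'a \<Rightarrow> real"
    assume f: "f \<in> borel_measurable M" "\<And>x. x \<in> space M \<Longrightarrow> 0 \<le> f x \<and> f x \<le> 1"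
    have "integrable \<mu> f"
      using f by (intro integrable_bounded_on[OF m(2,3)] boundedI[of _ 1]) auto
    then have "(\<integral>x. f x \<partial>\<mu>) \<le> 1" using f m by (intro \<mu>.integral_le_const) auto
    moreover have "0 \<le> (\<integral>x. f x \<partial>\<nu>)" using f n by (intro integral_nonneg_AE) auto
    ultimately show "(\<integral>x. f x \<partial>\<mu>) - (\<integral>x. f x \<partial>\<nu>) \<le> 1" by simp
  qed
  then show ?thesis by simp
qed

section \<open>The operator as integration against a kernel\<close>

text \<open>As \<open>inverse 0 = 0\<close>, this is the null measure when the overlap is 1.\<close>

definition V_measure :: "'a measure \<Rightarrow> ('a \<Rightarrow> 'a measure) \<Rightarrow> 'a \<times> 'a \<Rightarrow> ('a \<times> 'a) measure" where
  "V_measure M K z =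
    (let \<mu>1 = K (fst z); \<mu>2 = K (snd z); \<Lambda> = sum_measure \<mu>1 \<mu>2;
         p1 = dens \<Lambda> \<mu>1; p2 = dens \<Lambda> \<mu>2; m = (\<lambda>u. min (p1 u) (p2 u))
     in density (density \<Lambda> (\<lambda>u. p1 u - m u) \<Otimes>\<^sub>M density \<Lambda> (\<lambda>u. p2 u - m u))
          (\<lambda>_. inverse (1 - overlap \<Lambda> p1 p2)))"

text \<open>Both excess parts \<open>P = p - min p q\<close> and \<open>Q = q - min p q\<close> have
  mass \<open>1 - \<kappa>\<close>, so their product divided by \<open>1 - \<kappa>\<close> has mass
  \<open>1 - \<kappa>\<close>, at most 1. In the integral of \<open>f (fst u) - f (snd u)\<close>
  one coordinate integrates out of each term, and the common part \<open>min p q\<close>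
  cancels.\<close>

lemma
  assumes K: "K \<in> M \<rightarrow>\<^sub>M prob_algebra M" and x: "x1 \<in> space M" "x2 \<in> space M"
  shows finite_measure_V_measure: "finite_measure (V_measure M K (x1, x2))"
    and sets_V_measure: "sets (V_measure M K (x1, x2)) = sets (M \<Otimes>\<^sub>M M)"
    and measure_V_measure_le: "measure (V_measure M K (x1, x2)) (space (M \<Otimes>\<^sub>M M)) \<le> 1"
    and V_op_eq_integral: "\<And>h :: 'a \<times> 'a \<Rightarrow> 'b::{banach, second_countable_topology}.
      h \<in> borel_measurable (M \<Otimes>\<^sub>M M) \<Longrightarrow> bounded (h ` space (M \<Otimes>\<^sub>M M)) \<Longrightarrow>
      V_op M K h (x1, x2) = (\<integral>u. h u \<partial>V_measure M K (x1, x2))"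
    and V_measure_difference: "\<And>f :: 'a \<Rightarrow> real.
      f \<in> borel_measurable M \<Longrightarrow> bounded (f ` space M) \<Longrightarrow>
      (\<integral>u. f (fst u) - f (snd u) \<partial>V_measure M K (x1, x2)) = (\<integral>u. f u \<partial>K x1) - (\<integral>u. f u \<partial>K x2)"
proof -
  note m = prob_algebraD[OF measurable_space[OF K x(1)]]
    and n = prob_algebraD[OF measurable_space[OF K x(2)]]
  interpret k1: prob_space "K x1" by (rule m)
  interpret k2: prob_space "K x2" by (rule n)
  define L where "L = sum_measure (K x1) (K x2)"
  define p where "p = dens L (K x1)"
  define q where "q = dens L (K x2)"
  define \<kappa> where "\<kappa> = overlap L p q"
  define P where "P u = p u - min (p u) (q u)" for u
  define Q where "Q u = q u - min (p u) (q u)" for u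
  define \<alpha> where "\<alpha> = density L P"
  define \<beta> where "\<beta> = density L Q"
  define \<rho> where "\<rho> = V_measure M K (x1, x2)"
  have \<rho>: "\<rho> = density (\<alpha> \<Otimes>\<^sub>M \<beta>) (\<lambda>_. inverse (1 - \<kappa>))"
    by (simp add: \<rho>_def V_measure_def Let_def L_def p_def q_def \<kappa>_def \<alpha>_def \<beta>_def P_def Q_def)
  have sL [measurable_cong]: "sets L = sets M" and spL: "space L = space M"
    by (simp_all add: L_def m)
  interpret L: finite_measure L
    unfolding L_def using m n by (intro finite_sum_measure) auto
  have [measurable]: "p \<in> borel_measurable M" "q \<in> borel_measurable M"
    unfolding p_def q_def by measurable
  have [measurable]: "P \<in> borel_measurable M" "Q \<in> borel_measurable M"
    unfolding P_def Q_def by measurable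
  have s\<alpha> [measurable_cong]: "sets \<alpha> = sets M" and s\<beta> [measurable_cong]: "sets \<beta> = sets M"
    by (simp_all add: \<alpha>_def \<beta>_def sL)
  have sp: "space \<alpha> = space M" "space \<beta> = space M"
    using s\<alpha> s\<beta> by (auto dest: sets_eq_imp_space_eq)
  have s\<alpha>\<beta> [measurable_cong]: "sets (\<alpha> \<Otimes>\<^sub>M \<beta>) = sets (M \<Otimes>\<^sub>M M)"
    using s\<alpha> s\<beta> by (rule sets_pair_measure_cong)
  have sp\<alpha>\<beta>: "space (\<alpha> \<Otimes>\<^sub>M \<beta>) = space (M \<Otimes>\<^sub>M M)"
    using s\<alpha>\<beta> by (rule sets_eq_imp_space_eq)
  have pq0: "0 \<le> p u" "0 \<le> q u" for u by (simp_all add: p_def q_def dens_def)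
  have PQ0: "0 \<le> P u" "0 \<le> Q u" for u by (simp_all add: P_def Q_def)
  have d1: "density L p = K x1" and d2: "density L q = K x2"
    unfolding L_def p_def q_def using m n by (intro density_dens_sum_measure; simp)+
  have i: "integrable L (\<lambda>u. p u * g u)" "integrable L (\<lambda>u. q u * g u)"
    "(\<integral>u. g u \<partial>K x1) = (\<integral>u. p u * g u \<partial>L)" "(\<integral>u. g u \<partial>K x2) = (\<integral>u. q u * g u \<partial>L)"
    if [measurable]: "g \<in> borel_measurable M" and b: "bounded (g ` space M)" for g :: "'a \<Rightarrow> real"
    using integrable_bounded_on[OF m(2,3) that] integrable_bounded_on[OF n(2,3) that] pq0
    unfolding d1[symmetric] d2[symmetric] by (simp_all add: integrable_density integral_density)
  have ip: "integrable L p" "integrable L q" and ip1: "(\<integral>u. p u \<partial>L) = 1" "(\<integral>u. q u \<partial>L) = 1"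
    using i[of "\<lambda>_. 1"] by (simp_all add: image_constant_conv k1.prob_space k2.prob_space)
  have im: "integrable L (\<lambda>u. min (p u) (q u))" using ip by (rule integrable_min)
  have iP: "integrable L P" "integrable L Q" and iP1: "(\<integral>u. P u \<partial>L) = 1 - \<kappa>" "(\<integral>u. Q u \<partial>L) = 1 - \<kappa>"
    unfolding P_def Q_def \<kappa>_def overlap_def using ip ip1 im by simp_all
  have \<kappa>: "0 \<le> 1 - \<kappa>" using iP1(1) PQ0 by (metis integral_nonneg_AE AE_I2)
  have e\<alpha>: "emeasure \<alpha> (space M) = ennreal (1 - \<kappa>)"
    using iP PQ0 iP1 spL by (simp add: \<alpha>_def emeasure_density nn_integral_eq_integral
      cong: nn_integral_cong_simp flip: spL)
  have e\<beta>: "emeasure \<beta> (space M) = ennreal (1 - \<kappa>)"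
    using iP PQ0 iP1 spL by (simp add: \<beta>_def emeasure_density nn_integral_eq_integral
      cong: nn_integral_cong_simp flip: spL)
  interpret \<alpha>: finite_measure \<alpha> by (rule finite_measureI) (simp add: sp e\<alpha>)
  interpret \<beta>: finite_measure \<beta> by (rule finite_measureI) (simp add: sp e\<beta>)
  interpret pair_sigma_finite \<alpha> \<beta> ..
  have e\<alpha>\<beta>: "emeasure (\<alpha> \<Otimes>\<^sub>M \<beta>) (space (M \<Otimes>\<^sub>M M)) = ennreal ((1 - \<kappa>) * (1 - \<kappa>))"
    using \<beta>.emeasure_pair_measure_Times[of "space M" \<alpha> "space M"] \<kappa>
    by (simp add: e\<alpha> e\<beta> space_pair_measure s\<alpha> s\<beta> ennreal_mult)
  have fin\<alpha>\<beta>: "finite_measure (\<alpha> \<Otimes>\<^sub>M \<beta>)"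
    by (rule finite_measureI) (simp add: sp\<alpha>\<beta> e\<alpha>\<beta>)
  show s\<rho>: "sets (V_measure M K (x1, x2)) = sets (M \<Otimes>\<^sub>M M)"
    unfolding \<rho>_def[symmetric] \<rho> by (simp add: s\<alpha>\<beta>)
  have "emeasure \<rho> (space (M \<Otimes>\<^sub>M M)) = ennreal (inverse (1 - \<kappa>)) * ennreal ((1 - \<kappa>) * (1 - \<kappa>))"
    unfolding \<rho> by (simp add: emeasure_density_const e\<alpha>\<beta> s\<alpha>\<beta>)
  \<comment> \<open>For \<open>\<kappa> = 1\<close> both sides are 0.\<close>
  also have "\<dots> = ennreal (1 - \<kappa>)"
    using \<kappa> by (cases "\<kappa> = 1") (simp_all flip: ennreal_mult)
  finally have e\<rho>: "emeasure \<rho> (space (M \<Otimes>\<^sub>M M)) = ennreal (1 - \<kappa>)" .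
  show fin\<rho>: "finite_measure (V_measure M K (x1, x2))"
    using e\<rho> s\<rho> by (intro finite_measureI) (auto simp: \<rho>_def dest: sets_eq_imp_space_eq)
  have "0 \<le> \<kappa>" unfolding \<kappa>_def overlap_def using pq0 by (intro integral_nonneg_AE) simp
  then show "measure (V_measure M K (x1, x2)) (space (M \<Otimes>\<^sub>M M)) \<le> 1"
    using e\<rho> \<kappa> by (simp add: \<rho>_def[symmetric] measure_def)
  have fubini: "(\<integral>u. h u \<partial>\<rho>)
      = inverse (1 - \<kappa>) *\<^sub>R (\<integral>u1. P u1 *\<^sub>R (\<integral>u2. Q u2 *\<^sub>R h (u1, u2) \<partial>L) \<partial>L)"
    if [measurable]: "h \<in> borel_measurable (M \<Otimes>\<^sub>M M)" and b: "bounded (h ` space (M \<Otimes>\<^sub>M M))"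
    for h :: "'a \<times> 'a \<Rightarrow> 'c::{banach, second_countable_topology}"
  proof -
    have "(\<integral>u. h u \<partial>\<rho>) = inverse (1 - \<kappa>) *\<^sub>R (\<integral>u. h u \<partial>(\<alpha> \<Otimes>\<^sub>M \<beta>))"
      unfolding \<rho> using \<kappa> by (subst integral_density) auto
    also have "(\<integral>u. h u \<partial>(\<alpha> \<Otimes>\<^sub>M \<beta>)) = (\<integral>u1. (\<integral>u2. h (u1, u2) \<partial>\<beta>) \<partial>\<alpha>)"
      by (rule integral_fst'[symmetric]) (rule integrable_bounded_on[OF fin\<alpha>\<beta> s\<alpha>\<beta> that])
    also have "\<dots> = (\<integral>u1. P u1 *\<^sub>R (\<integral>u2. h (u1, u2) \<partial>\<beta>) \<partial>L)"
      unfolding \<alpha>_def using PQ0 by (subst integral_density) auto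
    also have "\<dots> = (\<integral>u1. P u1 *\<^sub>R (\<integral>u2. Q u2 *\<^sub>R h (u1, u2) \<partial>L) \<partial>L)"
    proof -
      have "(\<integral>u2. h (u1, u2) \<partial>\<beta>) = (\<integral>u2. Q u2 *\<^sub>R h (u1, u2) \<partial>L)" if "u1 \<in> space M" for u1
      proof -
        note [measurable] = that
        show ?thesis unfolding \<beta>_def using PQ0 by (subst integral_density) auto
      qed
      then show ?thesis by (intro Bochner_Integration.integral_cong) (simp_all add: spL)
    qed
    finally show ?thesis .
  qed
  show "V_op M K h (x1, x2) = (\<integral>u. h u \<partial>V_measure M K (x1, x2))"
    if h: "h \<in> borel_measurable (M \<Otimes>\<^sub>M M)" "bounded (h ` space (M \<Otimes>\<^sub>M M))" for h :: "'a \<times> 'a \<Rightarrow> 'b"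
  proof -
    let ?c = "inverse (1 - \<kappa>)"
    have e: "excess L p q p u = ?c * P u" "excess L p q q u = ?c * Q u" for u
      by (simp_all add: excess_def P_def Q_def \<kappa>_def divide_inverse)
    have "V_op M K h (x1, x2) = excess_integral L p q h"
      using x by (simp add: V_op_def Let_def L_def p_def q_def space_pair_measure)
    also have "\<dots> = (1 - \<kappa>) *\<^sub>R ?c *\<^sub>R ?c *\<^sub>R (\<integral>u1. P u1 *\<^sub>R (\<integral>u2. Q u2 *\<^sub>R h (u1, u2) \<partial>L) \<partial>L)"
    proof -
      have "(\<integral>u2. (?c * P u1 * (?c * Q u2)) *\<^sub>R h (u1, u2) \<partial>L)
          = ?c *\<^sub>R ?c *\<^sub>R P u1 *\<^sub>R (\<integral>u2. Q u2 *\<^sub>R h (u1, u2) \<partial>L)" for u1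
        by (simp flip: integral_scaleR_right add: ac_simps)
      then have "(\<integral>u1. (\<integral>u2. (?c * P u1 * (?c * Q u2)) *\<^sub>R h (u1, u2) \<partial>L) \<partial>L)
          = ?c *\<^sub>R ?c *\<^sub>R (\<integral>u1. P u1 *\<^sub>R (\<integral>u2. Q u2 *\<^sub>R h (u1, u2) \<partial>L) \<partial>L)"
        by (simp only: integral_scaleR_right)
      then show ?thesis
        by (simp add: excess_integral_def e flip: \<kappa>_def)
    qed
    also have "\<dots> = (\<integral>u. h u \<partial>\<rho>)"
      by (cases "\<kappa> = 1") (simp_all add: fubini[OF h])
    finally show ?thesis by (simp add: \<rho>_def)
  qed
  show "(\<integral>u. f (fst u) - f (snd u) \<partial>V_measure M K (x1, x2)) = (\<integral>u. f u \<partial>K x1) - (\<integral>u. f u \<partial>K x2)"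
    if f [measurable]: "f \<in> borel_measurable M" and b: "bounded (f ` space M)" for f :: "'a \<Rightarrow> real"
  proof -
    obtain B where B: "\<And>u. u \<in> space M \<Longrightarrow> \<bar>f u\<bar> \<le> B" using b by (auto simp: bounded_iff)
    have bb: "bounded ((\<lambda>u. f (fst u) - f (snd u)) ` space (M \<Otimes>\<^sub>M M))"
    proof (rule boundedI[of _ "2 * B"])
      fix y assume "y \<in> (\<lambda>u. f (fst u) - f (snd u)) ` space (M \<Otimes>\<^sub>M M)"
      then obtain a b where "a \<in> space M" "b \<in> space M" "y = f a - f b"
        by (auto simp: space_pair_measure)
      then show "norm y \<le> 2 * B" using B[of a] B[of b] by simp
    qed
    \<comment> \<open>Since \<open>0 \<le> P \<le> p\<close> and \<open>0 \<le> Q \<le> q\<close>,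
      the products with \<open>f\<close> are dominated by \<open>p * f\<close> and
      \<open>q * f\<close>.\<close>
    have iPf: "integrable L (\<lambda>u. P u * f u)" "integrable L (\<lambda>u. Q u * f u)"
      by (rule Bochner_Integration.integrable_bound[OF i(1)[OF f b]];
          use pq0 in \<open>auto intro!: AE_I2 mult_right_mono simp: P_def abs_mult\<close>)
         (rule Bochner_Integration.integrable_bound[OF i(2)[OF f b]];
          use pq0 in \<open>auto intro!: AE_I2 mult_right_mono simp: Q_def abs_mult\<close>)
    have diff: "(\<integral>u. f u \<partial>K x1) - (\<integral>u. f u \<partial>K x2) = (\<integral>u. P u * f u \<partial>L) - (\<integral>u. Q u * f u \<partial>L)"
    proof -
      have "(\<integral>u. f u \<partial>K x1) - (\<integral>u. f u \<partial>K x2) = (\<integral>u. p u * f u - q u * f u \<partial>L)"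
        using i[OF f b] by simp
      also have "\<dots> = (\<integral>u. P u * f u - Q u * f u \<partial>L)"
        by (simp add: P_def Q_def algebra_simps)
      finally show ?thesis using iPf by simp
    qed
    have "(\<integral>u. f (fst u) - f (snd u) \<partial>\<rho>)
      = inverse (1 - \<kappa>) * (\<integral>u1. P u1 * (\<integral>u2. Q u2 * (f u1 - f u2) \<partial>L) \<partial>L)"
      by (subst fubini[OF _ bb]) auto
    also have "(\<lambda>u1. P u1 * (\<integral>u2. Q u2 * (f u1 - f u2) \<partial>L))
       = (\<lambda>u1. (1 - \<kappa>) * (P u1 * f u1) - P u1 * (\<integral>u2. Q u2 * f u2 \<partial>L))"
    proof
      fix u1
      have *: "(\<integral>u2. Q u2 * (f u1 - f u2) \<partial>L) = (1 - \<kappa>) * f u1 - (\<integral>u2. Q u2 * f u2 \<partial>L)"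
        unfolding iP1(2)[symmetric] using iPf iP by (simp add: right_diff_distrib)
      show "P u1 * (\<integral>u2. Q u2 * (f u1 - f u2) \<partial>L)
          = (1 - \<kappa>) * (P u1 * f u1) - P u1 * (\<integral>u2. Q u2 * f u2 \<partial>L)"
        unfolding * by (simp add: algebra_simps)
    qed
    also have "(\<integral>u1. (1 - \<kappa>) * (P u1 * f u1) - P u1 * (\<integral>u2. Q u2 * f u2 \<partial>L) \<partial>L)
        = (1 - \<kappa>) * ((\<integral>u. P u * f u \<partial>L) - (\<integral>u. Q u * f u \<partial>L))"
      using iPf iP by (simp add: iP1(1) right_diff_distrib)
    also have "inverse (1 - \<kappa>) * \<dots> = (\<integral>u. P u * f u \<partial>L) - (\<integral>u. Q u * f u \<partial>L)"
    proof (cases "\<kappa> = 1")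
      \<comment> \<open>Here the left side is 0 through \<open>inverse 0 = 0\<close>. The right side
        is 0 as well, because nonnegative functions with integral \<open>1 - \<kappa> = 0\<close>
        vanish almost everywhere.\<close>
      case True
      then have "AE u in L. P u = 0" "AE u in L. Q u = 0"
        using iP iP1 PQ0 integral_nonneg_eq_0_iff_AE[of L P] integral_nonneg_eq_0_iff_AE[of L Q]
        by auto
      then have "(\<integral>u. P u * f u \<partial>L) = 0" "(\<integral>u. Q u * f u \<partial>L) = 0"
        by (auto intro!: integral_eq_zero_AE elim: eventually_mono)
      then show ?thesis by simp
    qed simp
    finally show ?thesis by (simp add: \<rho>_def diff)
  qed
qed

text \<open>\<open>V_measurable\<close> makes the tacit measurability of \<open>V h\<close>
  explicit, for real \<open>h\<close>. \<open>nonempty\<close> ensures that suprema over the carrier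
  are taken over nonempty sets.\<close>

locale V_kernel =
  fixes M :: "'a measure" and K :: "'a \<Rightarrow> 'a measure"
  assumes kernel: "K \<in> M \<rightarrow>\<^sub>M prob_algebra M"
    and V_measurable: "\<And>h :: 'a \<times> 'a \<Rightarrow> real. h \<in> borel_measurable (M \<Otimes>\<^sub>M M) \<Longrightarrow>
      bounded (h ` space (M \<Otimes>\<^sub>M M)) \<Longrightarrow> V_op M K h \<in> borel_measurable (M \<Otimes>\<^sub>M M)"
    and nonempty: "space M \<noteq> {}"
begin

abbreviation N where "N \<equiv> M \<Otimes>\<^sub>M M"

text \<open>In contrast to \<open>bdd_measurable\<close>, values off the carrier are free and the
  value type is arbitrary, so that real and complex functions share the same lemmas.\<close>

definition bm :: "('a \<times> 'a \<Rightarrow> 'b::{banach, second_countable_topology}) set" where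
  "bm = {h \<in> borel_measurable N. bounded (h ` space N)}"

lemma space_N: "space N \<noteq> {}"
  using nonempty by (simp add: space_pair_measure)

lemma V_outside: "z \<notin> space N \<Longrightarrow> V_op M K h z = 0"
  by (simp add: V_op_def)

lemma
  assumes "z \<in> space N"
  shows finite_V_measure: "finite_measure (V_measure M K z)"
    and sets_V_measure': "sets (V_measure M K z) = sets N"
    and space_V_measure: "space (V_measure M K z) = space N"
    and measure_V_measure: "measure (V_measure M K z) (space N) \<le> 1"
    and V_eq: "\<And>h :: 'a \<times> 'a \<Rightarrow> 'b::{banach, second_countable_topology}. h \<in> bm \<Longrightarrow>
      V_op M K h z = (\<integral>u. h u \<partial>V_measure M K z)"
proof -
  obtain x y where z: "z = (x, y)" "x \<in> space M" "y \<in> space M"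
    using assms by (auto simp: space_pair_measure)
  note facts = finite_measure_V_measure sets_V_measure measure_V_measure_le V_op_eq_integral
  show "finite_measure (V_measure M K z)" "sets (V_measure M K z) = sets N"
      "measure (V_measure M K z) (space N) \<le> 1"
    unfolding z(1) by (rule facts[OF kernel z(2,3)])+
  then show "space (V_measure M K z) = space N" by (auto dest: sets_eq_imp_space_eq)
  show "V_op M K h z = (\<integral>u. h u \<partial>V_measure M K z)" if "h \<in> bm"
    for h :: "'a \<times> 'a \<Rightarrow> 'b"
    using that unfolding z(1) bm_def by (intro V_op_eq_integral[OF kernel z(2,3)]) auto
qed

lemma V_integrable: "z \<in> space N \<Longrightarrow> h \<in> bm \<Longrightarrow> integrable (V_measure M K z) h"
  by (rule integrable_bounded_on[OF finite_V_measure sets_V_measure']) (auto simp: bm_def)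

section \<open>Contraction, positivity and linearity on bounded measurable functions\<close>

lemma bmI:
  fixes h :: "'a \<times> 'a \<Rightarrow> 'b::{banach, second_countable_topology}"
  assumes "h \<in> borel_measurable N" "\<And>z. z \<in> space N \<Longrightarrow> norm (h z) \<le> B"
  shows "h \<in> bm"
  using assms unfolding bm_def bounded_iff by blast

text \<open>\<open>V_measure\<close> has total mass at most 1, so \<open>V\<close> is a contraction
  for the sup-norm. The bound holds off the carrier too, where \<open>V_op\<close> is 0 and
  \<open>B\<close> is nonnegative.\<close>

lemma norm_V_le:
  fixes h :: "'a \<times> 'a \<Rightarrow> 'b::{banach, second_countable_topology}"
  assumes h: "h \<in> bm" and le: "\<And>u. u \<in> space N \<Longrightarrow> norm (h u) \<le> B"
  shows "norm (V_op M K h z) \<le> B"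
proof -
  have B: "0 \<le> B" using space_N le norm_ge_zero order_trans by (metis ex_in_conv)
  show ?thesis
  proof (cases "z \<in> space N")
    case True
    interpret finite_measure "V_measure M K z" by (rule finite_V_measure[OF True])
    have "norm (V_op M K h z) \<le> (\<integral>u. norm (h u) \<partial>V_measure M K z)"
      unfolding V_eq[OF True h] by (rule integral_norm_bound)
    also have "\<dots> \<le> (\<integral>u. B \<partial>V_measure M K z)"
      using V_integrable[OF True h] le by (intro integral_mono) (auto simp: space_V_measure[OF True])
    also have "\<dots> \<le> B"
      using measure_V_measure[OF True] B
      by (simp add: space_V_measure[OF True] mult_left_le_one_le)
    finally show ?thesis .
  qed (simp add: V_outside B)
qed

lemma V_mono:
  fixes g h :: "'a \<times> 'a \<Rightarrow> real"
  assumes "g \<in> bm" "h \<in> bm" "\<And>u. u \<in> space N \<Longrightarrow> g u \<le> h u"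
  shows "V_op M K g z \<le> V_op M K h z"
proof (cases "z \<in> space N")
  case True
  show ?thesis unfolding V_eq[OF True assms(1)] V_eq[OF True assms(2)]
    using assms V_integrable[OF True] by (intro integral_mono) (auto simp: space_V_measure[OF True])
qed (simp add: V_outside)

lemma bm_cmult: "h \<in> bm \<Longrightarrow> (\<lambda>u. c * h u) \<in> bm"
  for h :: "'a \<times> 'a \<Rightarrow> 'b::{real_normed_algebra, banach, second_countable_topology}"
proof -
  assume h: "h \<in> bm"
  then obtain B where B: "\<And>u. u \<in> space N \<Longrightarrow> norm (h u) \<le> B" by (auto simp: bm_def bounded_iff)
  show ?thesis
    using h B by (intro bmI[of _ "norm c * B"])
      (auto simp: bm_def intro!: order_trans[OF norm_mult_ineq] mult_left_mono)
qed

lemma bm_diff: "g \<in> bm \<Longrightarrow> h \<in> bm \<Longrightarrow> (\<lambda>u. g u - h u) \<in> bm"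
  by (auto simp: bm_def intro!: bounded_minus_comp)

lemma bm_0: "(\<lambda>u. 0) \<in> bm"
  by (rule bmI[of _ 0]) auto

lemma bm_add: "g \<in> bm \<Longrightarrow> h \<in> bm \<Longrightarrow> (\<lambda>u. g u + h u) \<in> bm"
  by (auto simp: bm_def intro!: bounded_plus_comp)

lemma bm_norm:
  fixes h :: "'a \<times> 'a \<Rightarrow> 'b::{banach, second_countable_topology}"
  assumes "h \<in> bm" shows "(\<lambda>u. norm (h u)) \<in> bm"
proof -
  obtain B where "\<And>u. u \<in> space N \<Longrightarrow> norm (h u) \<le> B"
    using assms by (auto simp: bm_def bounded_iff)
  moreover have "h \<in> borel_measurable N" using assms by (simp add: bm_def)
  ultimately show ?thesis by (intro bmI[of _ B]) auto
qed

lemma bm_sum: "(\<And>i. i \<in> I \<Longrightarrow> f i \<in> bm) \<Longrightarrow> (\<lambda>u. \<Sum>i\<in>I. f i u) \<in> bm"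
  by (induction I rule: infinite_finite_induct) (auto intro: bm_0 bm_add)

lemma V_cmult:
  fixes h :: "'a \<times> 'a \<Rightarrow> 'b::{real_normed_field, banach, second_countable_topology}"
  assumes "h \<in> bm"
  shows "V_op M K (\<lambda>u. c * h u) z = c * V_op M K h z"
  by (cases "z \<in> space N")
     (simp_all add: V_outside V_eq assms bm_cmult)

lemma V_diff: "g \<in> bm \<Longrightarrow> h \<in> bm \<Longrightarrow> V_op M K (\<lambda>u. g u - h u) z = V_op M K g z - V_op M K h z"
  by (cases "z \<in> space N") (simp_all add: V_outside V_eq bm_diff V_integrable)

lemma V_sum:
  assumes "\<And>i. i \<in> I \<Longrightarrow> f i \<in> bm"
  shows "V_op M K (\<lambda>u. \<Sum>i\<in>I. f i u) z = (\<Sum>i\<in>I. V_op M K (f i) z)"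
proof (cases "z \<in> space N")
  case True
  have "V_op M K (\<lambda>u. \<Sum>i\<in>I. f i u) z = (\<integral>u. (\<Sum>i\<in>I. f i u) \<partial>V_measure M K z)"
    by (rule V_eq[OF True bm_sum[OF assms]])
  also have "\<dots> = (\<Sum>i\<in>I. \<integral>u. f i u \<partial>V_measure M K z)"
    by (rule Bochner_Integration.integral_sum) (rule V_integrable[OF True assms])
  also have "\<dots> = (\<Sum>i\<in>I. V_op M K (f i) z)"
    by (intro sum.cong refl) (rule V_eq[OF True assms, symmetric])
  finally show ?thesis .
qed (simp add: V_outside)

lemma V_bm_real:
  fixes h :: "'a \<times> 'a \<Rightarrow> real"
  assumes "h \<in> bm" shows "V_op M K h \<in> bm"
proof -
  obtain B where "\<And>u. u \<in> space N \<Longrightarrow> norm (h u) \<le> B"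
    using assms by (auto simp: bm_def bounded_iff)
  then show ?thesis
    using V_measurable assms by (intro bmI[of _ B] norm_V_le) (auto simp: bm_def)
qed

lemma bm_of_real: "h \<in> bm \<Longrightarrow> (\<lambda>u. complex_of_real (h u)) \<in> bm"
  by (auto simp: bm_def bounded_iff)

lemma V_of_real: "h \<in> bm \<Longrightarrow> V_op M K (\<lambda>u. complex_of_real (h u)) z = complex_of_real (V_op M K h z)"
  by (cases "z \<in> space N") (simp_all add: V_outside V_eq bm_of_real)

lemma bm_Re_Im:
  assumes "h \<in> bm" shows "(\<lambda>u. Re (h u)) \<in> bm" "(\<lambda>u. Im (h u)) \<in> bm"
proof -
  obtain B where "\<And>u. u \<in> space N \<Longrightarrow> norm (h u) \<le> B"
    using assms by (auto simp: bm_def bounded_iff)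
  then have "norm (Re (h u)) \<le> B" "norm (Im (h u)) \<le> B" if "u \<in> space N" for u
    using that order_trans[OF abs_Re_le_cmod] order_trans[OF abs_Im_le_cmod] by simp_all
  moreover have "h \<in> borel_measurable N" using assms by (simp add: bm_def)
  ultimately show "(\<lambda>u. Re (h u)) \<in> bm" "(\<lambda>u. Im (h u)) \<in> bm"
    by (intro bmI[of _ B]; simp)+
qed

lemma V_Re_Im:
  assumes "h \<in> bm"
  shows "Re (V_op M K h z) = V_op M K (\<lambda>u. Re (h u)) z" "Im (V_op M K h z) = V_op M K (\<lambda>u. Im (h u)) z"
  using V_eq[OF _ assms, of z] V_eq[OF _ bm_Re_Im(1)[OF assms], of z]
    V_eq[OF _ bm_Re_Im(2)[OF assms], of z] V_integrable[OF _ assms, of z]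
  by (cases "z \<in> space N"; simp add: V_outside)+

text \<open>Measurability is assumed for real functions; it carries over because \<open>V\<close>
  commutes with taking real and imaginary parts.\<close>

lemma V_bm_complex:
  fixes h :: "'a \<times> 'a \<Rightarrow> complex"
  assumes "h \<in> bm" shows "V_op M K h \<in> bm"
proof -
  obtain B where B: "\<And>u. u \<in> space N \<Longrightarrow> norm (h u) \<le> B"
    using assms by (auto simp: bm_def bounded_iff)
  have "V_op M K h \<in> borel_measurable N"
    using V_bm_real[OF bm_Re_Im(1)[OF assms]] V_bm_real[OF bm_Re_Im(2)[OF assms]]
    by (simp add: borel_measurable_complex_iff V_Re_Im[OF assms] bm_def)
  then show ?thesis
    using B by (intro bmI[of _ B] norm_V_le[OF assms]) auto
qed

section \<open>Spectrum and growth of the iterates\<close>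

lemma bdd_measurable_iff: "h \<in> bdd_measurable N \<longleftrightarrow> h \<in> bm \<and> (\<forall>z. z \<notin> space N \<longrightarrow> h z = 0)"
proof -
  have "bounded (range h)" if "bounded (h ` space N)" "\<forall>z. z \<notin> space N \<longrightarrow> h z = 0"
  proof -
    have "range h \<subseteq> insert 0 (h ` space N)" using that(2) by auto
    then show ?thesis using that(1) bounded_insert bounded_subset by metis
  qed
  then show ?thesis
    unfolding bdd_measurable_def bm_def by (auto intro: bounded_subset)
qed

lemma le_sup_norm:
  assumes "h \<in> bdd_measurable N" "z \<in> space N"
  shows "cmod (h z) \<le> sup_norm N h"
proof -
  obtain B where "\<And>u. u \<in> space N \<Longrightarrow> cmod (h u) \<le> B"
    using assms(1) by (auto simp: bdd_measurable_iff bm_def bounded_iff)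
  then show ?thesis
    unfolding sup_norm_def using assms(2) by (intro cSUP_upper bdd_aboveI2[of _ _ B])
qed

lemma sup_norm_le: "(\<And>z. z \<in> space N \<Longrightarrow> cmod (h z) \<le> B) \<Longrightarrow> sup_norm N h \<le> B"
  unfolding sup_norm_def using space_N by (intro cSUP_least) auto

section \<open>The resolvent outside the closed unit disc\<close>

lemma resolvent_map_bdd_measurable:
  assumes "h \<in> bdd_measurable N"
  shows "(\<lambda>z. c * h z - V_op M K h z) \<in> bdd_measurable N"
  using assms by (auto simp: bdd_measurable_iff V_outside intro!: bm_diff bm_cmult V_bm_complex)

lemma V_power_bm_complex: "h \<in> bm \<Longrightarrow> (V_op M K ^^ n) h \<in> bm" for h :: "'a \<times> 'a \<Rightarrow> complex"
  by (induction n) (auto intro: V_bm_complex)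

lemma norm_V_power_le:
  fixes h :: "'a \<times> 'a \<Rightarrow> complex"
  assumes "h \<in> bm" "\<And>u. u \<in> space N \<Longrightarrow> norm (h u) \<le> B" "z \<in> space N"
  shows "norm ((V_op M K ^^ n) h z) \<le> B"
  using assms(3)
proof (induction n arbitrary: z)
  case (Suc n)
  then show ?case using norm_V_le[OF V_power_bm_complex[OF assms(1), of n]] by simp
qed (use assms in simp)

text \<open>Write \<open>c * h\<close> as \<open>(c * h - V h) + V h\<close> and use that
  \<open>V\<close> is a contraction. The estimate serves twice for \<open>c\<close> of modulus above
  1: it gives injectivity, and it is the bound on the inverse that \<open>resolvent_set\<close> asks
  for.\<close>

lemma sup_norm_resolvent_le:
  assumes h: "h \<in> bdd_measurable N" and c: "1 < cmod c"
  shows "sup_norm N h \<le> inverse (cmod c - 1) * sup_norm N (\<lambda>z. c * h z - V_op M K h z)"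
proof -
  let ?T = "\<lambda>z. c * h z - V_op M K h z"
  have "sup_norm N h \<le> (sup_norm N ?T + sup_norm N h) / cmod c"
  proof (rule sup_norm_le)
    fix z assume z: "z \<in> space N"
    have "cmod c * cmod (h z) = cmod (?T z + V_op M K h z)" by (simp add: norm_mult)
    also have "\<dots> \<le> cmod (?T z) + cmod (V_op M K h z)" by (rule norm_triangle_ineq)
    also have "cmod (?T z) \<le> sup_norm N ?T"
      using le_sup_norm[OF resolvent_map_bdd_measurable[OF h] z] .
    also have "cmod (V_op M K h z) \<le> sup_norm N h"
      using h le_sup_norm[OF h] by (intro norm_V_le) (auto simp: bdd_measurable_iff)
    finally show "cmod (h z) \<le> (sup_norm N ?T + sup_norm N h) / cmod c"
      using c by (subst pos_le_divide_eq) (auto simp: ac_simps)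
  qed
  then have "sup_norm N h * cmod c \<le> sup_norm N ?T + sup_norm N h"
    using c by (subst (asm) pos_le_divide_eq) auto
  then have "sup_norm N h * (cmod c - 1) \<le> sup_norm N ?T"
    by (simp add: algebra_simps)
  then have "sup_norm N h \<le> sup_norm N ?T / (cmod c - 1)"
    using c by (subst pos_le_divide_eq) auto
  then show ?thesis by (simp add: divide_inverse mult.commute)
qed

text \<open>Surjectivity: the solution is the sum of the \<open>V^k g / c^(k+1)\<close>. It
  converges because the k-th term is at most \<open>sup_norm N g / |c|^(k+1)\<close>, and applying
  \<open>V\<close> shifts the series by one term.\<close>

lemma neumann_series:
  assumes g: "g \<in> bdd_measurable N" and c: "1 < cmod c"
  obtains h where "h \<in> bdd_measurable N" "(\<lambda>z. c * h z - V_op M K h z) = g"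
proof -
  define u where "u k z = (V_op M K ^^ k) g z / c ^ Suc k" for k z
  define h where "h z = (\<Sum>k. u k z)" for z
  define G where "G = sup_norm N g"
  have c0: "c \<noteq> 0" using c by auto
  have g': "g \<in> bm" "\<And>z. z \<in> space N \<Longrightarrow> cmod (g z) \<le> G" "\<And>z. z \<notin> space N \<Longrightarrow> g z = 0"
    using g le_sup_norm[OF g] by (auto simp: bdd_measurable_iff G_def)
  have out: "(V_op M K ^^ k) g z = 0" if "z \<notin> space N" for k z
    using that g'(3) by (cases k) (auto simp: V_outside)
  have u_bm: "u k \<in> bm" for k
    using bm_cmult[OF V_power_bm_complex[OF g'(1), of k], of "inverse (c ^ Suc k)"]
    by (simp add: u_def[abs_def] divide_inverse mult.commute)
  have u_le: "norm (u k z) \<le> G * (1 / cmod c) ^ Suc k" if "z \<in> space N" for k z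
    using norm_V_power_le[OF g'(1,2) that, of k]
    by (simp add: u_def norm_divide norm_mult norm_power power_divide divide_right_mono)
  have sumG: "summable (\<lambda>k. G * (1 / cmod c) ^ Suc k)"
    using c by (intro summable_mult summable_ignore_initial_segment[where k=1, simplified] summable_geometric)
      (simp add: divide_less_eq)
  have u_sum: "summable (\<lambda>k. norm (u k z))" if "z \<in> space N" for z
    using u_le[OF that] by (intro summable_comparison_test'[OF sumG, of 0]) simp
  have h_le: "norm (h z) \<le> (\<Sum>k. G * (1 / cmod c) ^ Suc k)" if "z \<in> space N" for z
    unfolding h_def
    by (rule order_trans[OF summable_norm suminf_le]) (rule u_sum[OF that] u_le[OF that] sumG)+
  have h_bm: "h \<in> bm"
  proof (rule bmI[OF _ h_le])
    have "u k \<in> borel_measurable N" for k using u_bm by (simp add: bm_def)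
    then show "h \<in> borel_measurable N"
      unfolding h_def[abs_def] by (rule borel_measurable_suminf)
  qed
  have h_out: "h z = 0" if "z \<notin> space N" for z
    using out[OF that] by (simp add: h_def u_def)
  have "c * h z - V_op M K h z = g z" for z
  proof (cases "z \<in> space N")
    case True
    interpret finite_measure "V_measure M K z" by (rule finite_V_measure[OF True])
    have Vu: "V_op M K (u k) z = c * u (Suc k) z" for k
    proof -
      have "u k = (\<lambda>w. inverse (c ^ Suc k) * (V_op M K ^^ k) g w)"
        by (rule ext) (simp add: u_def divide_inverse)
      then have "V_op M K (u k) z = inverse (c ^ Suc k) * V_op M K ((V_op M K ^^ k) g) z"
        by (simp only: V_cmult[OF V_power_bm_complex[OF g'(1)]])
      then show ?thesis using c0 by (simp add: u_def divide_inverse)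
    qed
    have "V_op M K h z = (\<integral>w. (\<Sum>k. u k w) \<partial>V_measure M K z)"
      unfolding V_eq[OF True h_bm] by (simp add: h_def[abs_def])
    also have "\<dots> = (\<Sum>k. \<integral>w. u k w \<partial>V_measure M K z)"
    proof (rule integral_suminf)
      show "integrable (V_measure M K z) (u k)" for k by (rule V_integrable[OF True u_bm])
      show "AE w in V_measure M K z. summable (\<lambda>k. norm (u k w))"
        using u_sum by (intro AE_I2) (simp add: space_V_measure[OF True])
      \<comment> \<open>Exchanging sum and integral requires the integrated norms to be summable.
        They equal \<open>V\<close> applied to the norm of \<open>u k\<close>, so the contraction
        property gives the same geometric bound.\<close>
      have "norm (\<integral>w. norm (u k w) \<partial>V_measure M K z) \<le> G * (1 / cmod c) ^ Suc k" for k
      proof -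
        have "norm (V_op M K (\<lambda>w. norm (u k w)) z) \<le> G * (1 / cmod c) ^ Suc k"
          using u_le by (intro norm_V_le bm_norm u_bm) simp
        then show ?thesis by (simp only: V_eq[OF True bm_norm[OF u_bm]])
      qed
      then show "summable (\<lambda>k. \<integral>w. norm (u k w) \<partial>V_measure M K z)"
        by (intro summable_comparison_test'[OF sumG, of 0])
    qed
    also have "\<dots> = (\<Sum>k. c * u (Suc k) z)" by (simp add: Vu flip: V_eq[OF True u_bm])
    also have "\<dots> = c * (\<Sum>k. u (Suc k) z)"
      using summable_norm_cancel[OF u_sum[OF True]]
      by (intro suminf_mult) (subst summable_Suc_iff)
    also have "(\<Sum>k. u (Suc k) z) = h z - u 0 z"
      using summable_norm_cancel[OF u_sum[OF True]] unfolding h_def by (rule suminf_split_head)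
    finally show ?thesis using c0 by (simp add: u_def algebra_simps)
  qed (simp add: V_outside h_out g')
  then show ?thesis
    using h_bm h_out by (intro that[of h]) (auto simp: bdd_measurable_iff)
qed

text \<open>This confines the spectrum to the closed unit disc. Hence the supremum in
  \<open>spectral_radius\<close> runs over a bounded set and does dominate each spectral
  value.\<close>

lemma resolvent_set_outer:
  assumes c: "1 < cmod c"
  shows "c \<in> resolvent_set N (V_op M K)"
proof -
  let ?T = "\<lambda>h z. c * h z - V_op M K h z"
  have "inj_on ?T (bdd_measurable N)"
  proof (rule inj_onI)
    fix f g assume f: "f \<in> bdd_measurable N" and g: "g \<in> bdd_measurable N" and eq: "?T f = ?T g"
    let ?d = "\<lambda>z. f z - g z"
    have d: "?d \<in> bdd_measurable N" using f g by (auto simp: bdd_measurable_iff intro: bm_diff)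
    have "?T ?d z = 0" for z
      using fun_cong[OF eq, of z] f g
      by (simp add: V_diff bdd_measurable_iff algebra_simps)
    then have "sup_norm N (?T ?d) \<le> 0" by (intro sup_norm_le) simp
    then have "sup_norm N ?d \<le> 0"
      using sup_norm_resolvent_le[OF d c] c by (smt (verit) mult_nonneg_nonpos positive_imp_inverse_positive)
    then have "?d z = 0" for z
    proof (cases "z \<in> space N")
      case True
      have "cmod (?d z) \<le> 0"
        using le_sup_norm[OF d True] \<open>sup_norm N ?d \<le> 0\<close> by (rule order_trans)
      then show ?thesis by simp
    next
      case False
      then show ?thesis using d unfolding bdd_measurable_iff by blast
    qed
    then show "f = g" by (auto simp: fun_eq_iff)
  qed
  moreover have "?T ` bdd_measurable N = bdd_measurable N"
  proof (intro antisym subsetI)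
    fix g assume "g \<in> bdd_measurable N"
    then obtain h where "h \<in> bdd_measurable N" "?T h = g" by (rule neumann_series[OF _ c])
    then show "g \<in> ?T ` bdd_measurable N" by (intro image_eqI[of g ?T h]) (rule sym)
  next
    fix g assume "g \<in> ?T ` bdd_measurable N"
    then show "g \<in> bdd_measurable N" by (elim imageE) (simp only: resolvent_map_bdd_measurable)
  qed
  ultimately show ?thesis
    unfolding resolvent_set_def bij_betw_def
    by (intro CollectI conjI exI[of _ "inverse (cmod c - 1)"] ballI sup_norm_resolvent_le c)
qed

lemma le_spectral_radius:
  assumes "c \<in> spectrum N (V_op M K)"
  shows "cmod c \<le> spectral_radius N (V_op M K)"
  unfolding spectral_radius_def
proof (rule cSUP_upper[OF assms])
  show "bdd_above (cmod ` spectrum N (V_op M K))"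
    using resolvent_set_outer unfolding spectrum_def
    by (intro bdd_aboveI2[of _ _ 1]) (meson ComplD not_le)
qed

section \<open>Iterates of the constant function one\<close>

definition V_iter :: "nat \<Rightarrow> 'a \<times> 'a \<Rightarrow> real" where
  "V_iter n = (V_op M K ^^ n) (indicator (space N))"

text \<open>As \<open>V\<close> is positive, this is the operator norm of the n-th power of
  \<open>V\<close>.\<close>

definition V_growth :: "nat \<Rightarrow> real" where
  "V_growth n = (SUP z\<in>space N. V_iter n z)"

lemma V_iter_0: "V_iter 0 = indicator (space N)" and V_iter_Suc: "V_iter (Suc n) = V_op M K (V_iter n)"
  by (simp_all add: V_iter_def)

lemma V_iter_outside: "z \<notin> space N \<Longrightarrow> V_iter n z = 0"
  by (cases n) (simp_all add: V_iter_0 V_iter_Suc V_outside)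

lemma V_power_bm: "h \<in> bm \<Longrightarrow> (V_op M K ^^ n) h \<in> bm" for h :: "'a \<times> 'a \<Rightarrow> real"
  by (induction n) (auto intro: V_bm_real)

lemma V_iter_bm: "V_iter n \<in> bm"
  unfolding V_iter_def by (intro V_power_bm bmI[of _ 1]) (auto simp: indicator_def)

lemma V_iter_bounds: "0 \<le> V_iter n z \<and> V_iter n z \<le> 1"
proof (induction n arbitrary: z)
  case (Suc n)
  have "V_op M K (\<lambda>u. 0 :: real) z = 0" using V_cmult[OF bm_0, of 0 z] by simp
  then have "0 \<le> V_op M K (V_iter n) z" using V_mono[OF bm_0 V_iter_bm, of n z] Suc by simp
  moreover have "norm (V_op M K (V_iter n) z) \<le> 1" using Suc by (intro norm_V_le V_iter_bm) simp
  ultimately show ?case by (simp add: V_iter_Suc)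
qed (simp add: V_iter_0 indicator_def)

lemma V_iter_le_growth: "V_iter n z \<le> V_growth n"
proof -
  have le: "V_iter n u \<le> V_growth n" if "u \<in> space N" for u
    unfolding V_growth_def using that V_iter_bounds by (intro cSUP_upper bdd_aboveI2[of _ _ 1]) auto
  moreover obtain u where "u \<in> space N" using space_N by auto
  then have "0 \<le> V_growth n" using le[of u] V_iter_bounds[of n u] by linarith
  ultimately show ?thesis using V_iter_outside by (cases "z \<in> space N") auto
qed

lemma V_growth_le: "(\<And>z. z \<in> space N \<Longrightarrow> V_iter n z \<le> B) \<Longrightarrow> V_growth n \<le> B"
  unfolding V_growth_def using space_N by (intro cSUP_least) auto

lemma V_growth_nonneg: "0 \<le> V_growth n"
  using V_iter_le_growth V_iter_bounds order_trans by blast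

text \<open>By positivity, \<open>h \<le> c\<close> is preserved in the form
  \<open>V^n h \<le> c * V^n 1\<close>.\<close>

lemma V_power_le:
  fixes h :: "'a \<times> 'a \<Rightarrow> real"
  assumes h: "h \<in> bm" "\<And>u. u \<in> space N \<Longrightarrow> h u \<le> c" and z: "z \<in> space N"
  shows "(V_op M K ^^ n) h z \<le> c * V_iter n z"
  using z
proof (induction n arbitrary: z)
  case (Suc n)
  have "V_op M K ((V_op M K ^^ n) h) z \<le> V_op M K (\<lambda>u. c * V_iter n u) z"
    using Suc by (intro V_mono V_power_bm h bm_cmult V_iter_bm)
  then show ?case by (simp add: V_cmult[OF V_iter_bm] V_iter_Suc)
qed (simp add: h V_iter_0)

text \<open>Apply \<open>V^m\<close> to \<open>V^n 1 \<le> V_growth n\<close>. The factor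
  \<open>V_iter m z\<close> is kept pointwise because it is later summed over \<open>m\<close>
  before any supremum is taken.\<close>

lemma V_iter_add_le: "V_iter (m + n) z \<le> V_growth n * V_iter m z"
proof (cases "z \<in> space N")
  case True
  have "V_iter (m + n) z = (V_op M K ^^ m) (V_iter n) z" by (simp add: V_iter_def funpow_add)
  also have "\<dots> \<le> V_growth n * V_iter m z" using V_iter_le_growth True by (intro V_power_le V_iter_bm)
  finally show ?thesis .
qed (simp add: V_iter_outside)

text \<open>Submultiplicativity of the norm, iterated: a bound at a single exponent \<open>m\<close>
  spreads to all its multiples.\<close>

lemma V_growth_mult_le: "V_growth (m * n) \<le> V_growth m ^ n"
proof (induction n)
  case 0
  show ?case using V_iter_bounds by (auto intro!: V_growth_le)
next
  case (Suc n)
  have "V_iter (m * Suc n) z \<le> V_growth m * V_growth (m * n)" for z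
    using V_iter_add_le[of "m * n" m z] mult_left_mono[OF V_iter_le_growth[of "m * n" z] V_growth_nonneg[of m]]
    by (simp add: add.commute)
  then have "V_growth (m * Suc n) \<le> V_growth m * V_growth (m * n)" by (rule V_growth_le)
  also have "\<dots> \<le> V_growth m ^ Suc n" using Suc V_growth_nonneg by (simp add: mult_left_mono)
  finally show ?case .
qed

section \<open>Truncated Neumann series and the spectral point on the positive axis\<close>

definition partial_resolvent :: "real \<Rightarrow> nat \<Rightarrow> 'a \<times> 'a \<Rightarrow> real" where
  "partial_resolvent s n z = (\<Sum>k<n. V_iter k z / s ^ Suc k)"

lemma partial_resolvent_bm: "partial_resolvent s n \<in> bm"
  unfolding partial_resolvent_def [abs_def] divide_inverse mult.commute[of "V_iter _ _"]
  by (intro bm_sum bm_cmult V_iter_bm)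

text \<open>The sum telescopes. The last term measures how far the truncated series is from solving
  \<open>s * r - V r = 1\<close>.\<close>

lemma partial_resolvent_eq:
  assumes "s \<noteq> 0" "z \<in> space N"
  shows "s * partial_resolvent s n z - V_op M K (partial_resolvent s n) z = 1 - V_iter n z / s ^ n"
proof -
  have "V_op M K (partial_resolvent s n) z = (\<Sum>k<n. inverse (s ^ Suc k) * V_iter (Suc k) z)"
    unfolding partial_resolvent_def [abs_def] divide_inverse mult.commute[of "V_iter _ _"]
    by (simp add: V_sum bm_cmult V_iter_bm V_cmult V_iter_Suc)
  moreover have "s * partial_resolvent s n z = (\<Sum>k<n. V_iter k z / s ^ k)"
    using assms by (simp add: partial_resolvent_def sum_distrib_left)
  ultimately have "s * partial_resolvent s n z - V_op M K (partial_resolvent s n) z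
      = (\<Sum>k<n. V_iter k z / s ^ k - V_iter (Suc k) z / s ^ Suc k)"
    by (simp add: sum_subtractf divide_inverse mult.commute)
  also have "\<dots> = V_iter 0 z / s ^ 0 - V_iter n z / s ^ n"
    by (rule sum_lessThan_telescope')
  finally show ?thesis using assms by (simp add: V_iter_0)
qed

lemma partial_resolvent_mono:
  assumes "0 < s" "m \<le> n"
  shows "partial_resolvent s m z \<le> partial_resolvent s n z"
  unfolding partial_resolvent_def using assms V_iter_bounds
  by (intro sum_mono2) auto

lemma partial_resolvent_nonneg: "0 < s \<Longrightarrow> 0 \<le> partial_resolvent s n z"
  unfolding partial_resolvent_def using V_iter_bounds by (intro sum_nonneg) auto

text \<open>Assumptions \<open>le\<close> and \<open>sharp\<close> say that \<open>\<rho>\<close> is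
  the infimum of the k-th roots of \<open>V_growth k\<close>. Of a supposed resolvent at
  \<open>\<rho>\<close> only the norm bound is used: it controls the truncated series uniformly,
  first for \<open>s > \<rho>\<close> and then at \<open>\<rho>\<close>. This makes
  \<open>n * V_growth n / \<rho>^n\<close> bounded, against \<open>le\<close>.\<close>

lemma positive_spectral_point:
  assumes \<rho>: "0 < \<rho>" and le: "\<And>k. 1 \<le> k \<Longrightarrow> \<rho> ^ k \<le> V_growth k"
    and sharp: "\<And>s. \<rho> < s \<Longrightarrow> \<exists>k\<ge>1. V_growth k < s ^ k"
  shows "complex_of_real \<rho> \<in> spectrum N (V_op M K)"
proof (rule ccontr)
  let ?r = partial_resolvent
  assume "\<not> ?thesis"
  then obtain C0 where C0: "\<And>h. h \<in> bdd_measurable N \<Longrightarrow>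
      sup_norm N h \<le> C0 * sup_norm N (\<lambda>z. complex_of_real \<rho> * h z - V_op M K h z)"
    by (auto simp: spectrum_def resolvent_set_def)
  \<comment> \<open>The constant from \<open>resolvent_set\<close> may be any real number; the
    maximum with 1 makes it positive, so that \<open>1 / (2 * C)\<close> makes sense below.\<close>
  define C where "C = max C0 1"
  have C: "0 < C" "C0 \<le> C" by (simp_all add: C_def)
  have bound: "g z \<le> C * B"
    if g: "g \<in> bm" "\<And>z. z \<notin> space N \<Longrightarrow> g z = 0"
      and B: "\<And>z. z \<in> space N \<Longrightarrow> \<bar>\<rho> * g z - V_op M K g z\<bar> \<le> B" and z: "z \<in> space N" for g B z
  proof -
    let ?h = "\<lambda>z. complex_of_real (g z)"
    let ?T = "\<lambda>z. complex_of_real \<rho> * ?h z - V_op M K ?h z"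
    have h: "?h \<in> bdd_measurable N" using g by (simp add: bdd_measurable_iff bm_of_real)
    have "?T z = complex_of_real (\<rho> * g z - V_op M K g z)" for z
      by (simp add: V_of_real[OF g(1)])
    then have "sup_norm N ?T \<le> B" using B by (intro sup_norm_le) (simp only: norm_of_real)
    moreover have "0 \<le> sup_norm N ?T"
      using le_sup_norm[OF resolvent_map_bdd_measurable[OF h] z] norm_ge_zero order_trans by blast
    moreover have "g z \<le> sup_norm N ?h"
      using le_sup_norm[OF h z] by simp
    ultimately show ?thesis
      using C0[OF h] C by (smt (verit) mult_left_mono mult_right_mono)
  qed
  have step1: "?r s n z \<le> 4 * C"
    if s: "\<rho> < s" "C * (s - \<rho>) \<le> 1 / 2" and z: "z \<in> space N" for s n z
  proof -
    obtain k where k: "1 \<le> k" "V_growth k < s ^ k" using sharp[OF s(1)] by auto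
    \<comment> \<open>As a multiple of \<open>k\<close>, \<open>m\<close> satisfies
      \<open>V_growth m \<le> s ^ m\<close>, which keeps the remainder of the truncation at
      \<open>m\<close> within \<open>[0, 1]\<close>. As \<open>m \<ge> n\<close>, this truncation
      dominates the one at \<open>n\<close>.\<close>
    define m where "m = k * n"
    have s0: "0 < s" using s \<rho> by simp
    have "V_growth m \<le> s ^ m"
      using V_growth_mult_le[of k n] power_mono[OF less_imp_le[OF k(2)] V_growth_nonneg, of n]
      by (simp add: m_def power_mult)
    then have vm: "V_iter m u / s ^ m \<le> 1" for u
      using V_iter_le_growth[of m u] s0 by (simp add: divide_le_eq)
    define G where "G = (SUP u\<in>space N. ?r s m u)"
    obtain B where B: "\<And>u. u \<in> space N \<Longrightarrow> norm (?r s m u) \<le> B"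
      using partial_resolvent_bm[of s m] by (auto simp: bm_def bounded_iff)
    have G: "?r s m u \<le> G" if "u \<in> space N" for u
      unfolding G_def
    proof (intro cSUP_upper that bdd_aboveI2[of _ _ B])
      show "?r s m u \<le> B" if "u \<in> space N" for u using B[OF that] by simp
    qed
    \<comment> \<open>The resolvent bound at \<open>\<rho>\<close> is applied to the truncated
      series at \<open>s\<close>; the change of parameter adds the error
      \<open>(s - \<rho>) * ?r s m\<close>.\<close>
    have "?r s m u \<le> C * (2 + (s - \<rho>) * G)" if u: "u \<in> space N" for u
    proof (rule bound[OF _ _ _ u])
      show "?r s m \<in> bm" by (rule partial_resolvent_bm)
      show "?r s m w = 0" if "w \<notin> space N" for w
        by (simp add: partial_resolvent_def V_iter_outside[OF that])
      fix w assume w: "w \<in> space N"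
      have "\<rho> * ?r s m w - V_op M K (?r s m) w = 1 - V_iter m w / s ^ m - (s - \<rho>) * ?r s m w"
        using partial_resolvent_eq[OF _ w, of s m] s0 by (simp add: algebra_simps)
      moreover have "0 \<le> V_iter m w / s ^ m" using V_iter_bounds s0 by simp
      moreover have "0 \<le> (s - \<rho>) * ?r s m w" using partial_resolvent_nonneg[OF s0] s by simp
      moreover have "(s - \<rho>) * ?r s m w \<le> (s - \<rho>) * G" using G[OF w] s by (intro mult_left_mono) auto
      ultimately show "\<bar>\<rho> * ?r s m w - V_op M K (?r s m) w\<bar> \<le> 2 + (s - \<rho>) * G"
        using vm[of w] by linarith
    qed
    then have "G \<le> C * (2 + (s - \<rho>) * G)" unfolding G_def using space_N by (intro cSUP_least) auto
    also have "\<dots> = 2 * C + C * (s - \<rho>) * G" by (simp add: algebra_simps)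
    \<comment> \<open>Absorption: \<open>G\<close> is a finite nonnegative number with coefficient
      at most 1/2, so half of it can be moved to the left side.\<close>
    also have "\<dots> \<le> 2 * C + 1 / 2 * G"
      using s(2) G[OF z] partial_resolvent_nonneg[OF s0, of m z]
      by (intro add_left_mono mult_right_mono) auto
    finally have "G \<le> 4 * C" by simp
    moreover have "?r s n z \<le> ?r s m z" using k by (intro partial_resolvent_mono s0) (simp add: m_def)
    ultimately show ?thesis using G[OF z] by simp
  qed
  \<comment> \<open>For fixed \<open>n\<close> the truncated series is a finite sum, continuous in
    \<open>s\<close>, and the bound \<open>4 * C\<close> depends neither on \<open>s\<close> nor on
    \<open>n\<close>; it survives the limit from the right.\<close>
  have step2: "?r \<rho> n z \<le> 4 * C" if z: "z \<in> space N" for n z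
  proof (rule tendsto_upperbound)
    show "((\<lambda>s. ?r s n z) \<longlongrightarrow> ?r \<rho> n z) (at_right \<rho>)"
      unfolding partial_resolvent_def using \<rho> by (intro tendsto_intros) auto
    have "eventually (\<lambda>s. \<rho> < s \<and> s < \<rho> + 1 / (2 * C)) (at_right \<rho>)"
      using C by (intro eventually_conj eventually_at_right_less eventually_at_rightI[of _ "\<rho> + 1 / (2 * C)"]) auto
    then show "eventually (\<lambda>s. ?r s n z \<le> 4 * C) (at_right \<rho>)"
    proof eventually_elim
      case (elim s)
      then show ?case using C by (intro step1 z) (auto simp: field_simps)
    qed
  qed simp
  have ak: "V_growth k \<le> 4 * C * \<rho> ^ Suc k" for k
  proof (rule V_growth_le)
    fix z assume z: "z \<in> space N"
    have "V_iter k z / \<rho> ^ Suc k \<le> ?r \<rho> (Suc k) z"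
      using partial_resolvent_nonneg[OF \<rho>, of k z] by (simp add: partial_resolvent_def)
    also have "\<dots> \<le> 4 * C" by (rule step2[OF z])
    finally show "V_iter k z \<le> 4 * C * \<rho> ^ Suc k" using \<rho> by (simp add: divide_le_eq)
  qed
  \<comment> \<open>The gain of a factor \<open>n\<close>: split \<open>V^n 1\<close> in the
    \<open>n\<close> ways \<open>k + (n - k)\<close>, estimate the second part by \<open>ak\<close>,
    and recognise the sum over the first parts as the truncated series at \<open>\<rho>\<close>,
    which is bounded by \<open>step2\<close>.\<close>
  have bound_n: "real n * V_growth n \<le> 16 * C ^ 2 * \<rho> ^ 2 * \<rho> ^ n" for n
  proof (cases "n = 0")
    case False
    have "V_growth n \<le> 16 * C ^ 2 * \<rho> ^ 2 * \<rho> ^ n / n"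
    proof (rule V_growth_le)
      fix z assume z: "z \<in> space N"
      have "real n * V_iter n z = (\<Sum>k<n. V_iter (k + (n - k)) z)" by simp
      also have "\<dots> \<le> (\<Sum>k<n. 4 * C * \<rho> ^ (n + 2) * (V_iter k z / \<rho> ^ Suc k))"
      proof (rule sum_mono)
        fix k assume k: "k \<in> {..<n}"
        have "V_iter (k + (n - k)) z \<le> V_growth (n - k) * V_iter k z" by (rule V_iter_add_le)
        also have "\<dots> \<le> 4 * C * \<rho> ^ Suc (n - k) * V_iter k z"
          using ak V_iter_bounds by (intro mult_right_mono) auto
        \<comment> \<open>The exponents \<open>n - k + 1\<close> and \<open>k + 1\<close> add up to
          \<open>n + 2\<close>, so the constant in front no longer depends on
          \<open>k\<close>.\<close>
        also have "\<rho> ^ Suc (n - k) = \<rho> ^ (n + 2) / \<rho> ^ Suc k"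
        proof -
          have "\<rho> ^ (n + 2) = \<rho> ^ Suc (n - k) * \<rho> ^ Suc k"
            using k by (simp flip: power_add power_Suc)
          then show ?thesis using \<rho> by simp
        qed
        finally show "V_iter (k + (n - k)) z \<le> 4 * C * \<rho> ^ (n + 2) * (V_iter k z / \<rho> ^ Suc k)"
          by (simp only: mult.assoc times_divide_eq_left times_divide_eq_right)
      qed
      also have "\<dots> = 4 * C * \<rho> ^ (n + 2) * ?r \<rho> n z"
        by (simp add: partial_resolvent_def sum_distrib_left)
      also have "\<dots> \<le> 4 * C * \<rho> ^ (n + 2) * (4 * C)"
        using step2[OF z] C \<rho> by (intro mult_left_mono) auto
      finally show "V_iter n z \<le> 16 * C ^ 2 * \<rho> ^ 2 * \<rho> ^ n / n"
        using False by (simp add: field_simps power2_eq_square)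
    qed
    then show ?thesis using False by (simp add: field_simps)
  qed (use \<rho> in simp)
  obtain n where n: "16 * C ^ 2 * \<rho> ^ 2 < real n" using reals_Archimedean2 by blast
  have "0 \<le> 16 * C ^ 2 * \<rho> ^ 2" by simp
  then have "0 < real n" using n by linarith
  then have "1 \<le> n" by simp
  have "16 * C ^ 2 * \<rho> ^ 2 * \<rho> ^ n < real n * \<rho> ^ n" using n \<rho> by simp
  also have "\<dots> \<le> real n * V_growth n" using le[OF \<open>1 \<le> n\<close>] by (intro mult_left_mono) auto
  finally show False using bound_n[of n] by simp
qed

text \<open>If no \<open>k\<close> worked, all roots of \<open>V_growth k\<close> would be at least
  \<open>t\<close>, hence so would their infimum \<open>\<rho>\<close>. But \<open>\<rho>\<close>
  would then be positive and a spectral value, hence at most the spectral radius.\<close>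

lemma power_bound_of_spectral_radius:
  assumes "0 < t" "spectral_radius N (V_op M K) < t"
  shows "\<exists>k\<ge>1. V_growth k < t ^ k"
proof (rule ccontr)
  assume "\<not> ?thesis"
  then have t: "t ^ k \<le> V_growth k" if "1 \<le> k" for k using that by force
  \<comment> \<open>The infimum starts at 1 because \<open>root 0\<close> is constantly 0.\<close>
  define \<rho> where "\<rho> = (INF k\<in>{1..}. root k (V_growth k))"
  have bdd: "bdd_below ((\<lambda>k. root k (V_growth k)) ` {1..})"
    using V_growth_nonneg by (intro bdd_belowI2[of _ 0]) auto
  have "t \<le> \<rho>"
    unfolding \<rho>_def
  proof (rule cINF_greatest)
    fix k :: nat assume "k \<in> {1..}"
    then have "t = root k (t ^ k)" "0 < k" using assms(1) by (auto simp: real_root_power_cancel)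
    then show "t \<le> root k (V_growth k)" using t[of k] by (metis One_nat_def Suc_leI real_root_le_iff)
  qed simp
  have le: "\<rho> ^ k \<le> V_growth k" if "1 \<le> k" for k
  proof -
    have "\<rho> \<le> root k (V_growth k)" unfolding \<rho>_def using that by (intro cINF_lower bdd) auto
    then have "\<rho> ^ k \<le> root k (V_growth k) ^ k" using \<open>t \<le> \<rho>\<close> assms(1) by (intro power_mono) auto
    then show ?thesis using that V_growth_nonneg by (simp add: real_root_pow_pos2)
  qed
  have sharp: "\<exists>k\<ge>1. V_growth k < s ^ k" if "\<rho> < s" for s
  proof -
    obtain k where k: "1 \<le> k" "root k (V_growth k) < s"
      using \<open>\<rho> < s\<close> unfolding \<rho>_def by (subst (asm) cINF_less_iff[OF _ bdd]) auto
    then have "root k (V_growth k) ^ k < s ^ k" using V_growth_nonneg by (intro power_strict_mono) auto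
    then show ?thesis using k V_growth_nonneg by (auto simp: real_root_pow_pos2)
  qed
  have "cmod (complex_of_real \<rho>) \<le> spectral_radius N (V_op M K)"
    using assms(1) \<open>t \<le> \<rho>\<close> by (intro le_spectral_radius positive_spectral_point le sharp) auto
  then show False using \<open>t \<le> \<rho>\<close> assms by simp
qed

end

section \<open>Nonlinear chains\<close>

lemma kernel_integral_measurable:
  fixes f :: "'a \<Rightarrow> real"
  assumes "K \<in> M \<rightarrow>\<^sub>M prob_algebra M" "f \<in> borel_measurable M"
  shows "(\<lambda>x. \<integral>y. f y \<partial>K x) \<in> borel_measurable M"
  using measurable_compose[OF measurable_prob_algebraD[OF assms(1)]
      integral_measurable_subprob_algebra[OF assms(2)]] by simp

lemma prob_integral_bounds:
  fixes f :: "'a \<Rightarrow> real"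
  assumes "\<mu> \<in> space (prob_algebra M)" "f \<in> borel_measurable M"
    and "\<And>x. x \<in> space M \<Longrightarrow> 0 \<le> f x \<and> f x \<le> 1"
  shows "0 \<le> (\<integral>x. f x \<partial>\<mu>) \<and> (\<integral>x. f x \<partial>\<mu>) \<le> 1"
proof -
  note m = prob_algebraD[OF assms(1)]
  interpret \<mu>: prob_space \<mu> by (rule m)
  have "integrable \<mu> f"
    using assms(2,3) by (intro integrable_bounded_on[OF m(2,3)] boundedI[of _ 1]) auto
  then show ?thesis
    using assms(3) m by (intro conjI \<mu>.integral_le_const \<mu>.integral_ge_const) auto
qed

lemma integral_bind_prob:
  fixes f :: "'a \<Rightarrow> real"
  assumes \<mu>: "\<mu> \<in> space (prob_algebra M)" and R: "R \<in> M \<rightarrow>\<^sub>M prob_algebra M"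
    and f: "f \<in> borel_measurable M" "\<And>x. x \<in> space M \<Longrightarrow> 0 \<le> f x \<and> f x \<le> 1"
  shows "(\<integral>x. f x \<partial>(\<mu> \<bind> R)) = (\<integral>x. (\<integral>y. f y \<partial>R x) \<partial>\<mu>)"
proof (rule integral_bind[where B = 1 and B' = 1])
  note m = prob_algebraD[OF \<mu>]
  show "R \<in> \<mu> \<rightarrow>\<^sub>M subprob_algebra M"
    using measurable_prob_algebraD[OF R] m by (simp cong: measurable_cong_sets)
  show "AE x in \<mu>. emeasure (R x) (space (R x)) \<le> ennreal 1"
  proof (rule AE_I2)
    fix x assume "x \<in> space \<mu>"
    then have "prob_space (R x)" using prob_algebraD(1)[OF measurable_space[OF R]] m by simp
    then show "emeasure (R x) (space (R x)) \<le> ennreal 1"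
      by (simp add: prob_space.emeasure_space_1)
  qed
qed (use f prob_algebraD[OF \<mu>] in auto)

lemma bind_in_prob_algebra:
  assumes "\<mu> \<in> space (prob_algebra M)" "R \<in> M \<rightarrow>\<^sub>M prob_algebra M"
  shows "\<mu> \<bind> R \<in> space (prob_algebra M)"
  using measurable_space[OF measurable_bind_prob_space[OF measurable_ident assms(2)] assms(1)] by simp

text \<open>The density bound gives the factor \<open>1 + c\<close>, and \<open>f \<le> 1\<close>
  turns it into the additive error \<open>c\<close>. Passing to \<open>1 - f\<close> yields the
  opposite inequality.\<close>

lemma RN_deriv_le_integral_le:
  fixes f :: "'a \<Rightarrow> real"
  assumes \<mu>: "\<mu> \<in> space (prob_algebra M)" and \<nu>: "\<nu> \<in> space (prob_algebra M)"
    and ac: "absolutely_continuous \<nu> \<mu>"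
    and ratio: "AE y in \<nu>. RN_deriv \<nu> \<mu> y \<le> ennreal (1 + c)" and c: "0 \<le> c"
    and f: "f \<in> borel_measurable M" "\<And>x. x \<in> space M \<Longrightarrow> 0 \<le> f x \<and> f x \<le> 1"
  shows "(\<integral>x. f x \<partial>\<mu>) \<le> (\<integral>x. f x \<partial>\<nu>) + c"
proof -
  note m = prob_algebraD[OF \<mu>] and n = prob_algebraD[OF \<nu>]
  interpret \<nu>: prob_space \<nu> by (rule n)
  have f\<mu>: "f \<in> borel_measurable \<mu>" and f\<nu> [measurable]: "f \<in> borel_measurable \<nu>"
    using f(1) m n by (simp_all cong: measurable_cong_sets)
  have "(\<integral>\<^sup>+x. ennreal (f x) \<partial>\<mu>) = (\<integral>\<^sup>+x. ennreal (f x) \<partial>density \<nu> (RN_deriv \<nu> \<mu>))"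
    using \<nu>.density_RN_deriv[OF ac] m n by simp
  also have "\<dots> = (\<integral>\<^sup>+x. RN_deriv \<nu> \<mu> x * ennreal (f x) \<partial>\<nu>)"
    by (rule nn_integral_density) auto
  also have "\<dots> \<le> (\<integral>\<^sup>+x. ennreal (1 + c) * ennreal (f x) \<partial>\<nu>)"
    using ratio by (intro nn_integral_mono_AE) (auto elim!: eventually_mono intro: mult_right_mono)
  also have "\<dots> = ennreal (1 + c) * (\<integral>\<^sup>+x. ennreal (f x) \<partial>\<nu>)"
    by (rule nn_integral_cmult) auto
  finally have nn: "(\<integral>\<^sup>+x. ennreal (f x) \<partial>\<mu>) \<le> ennreal (1 + c) * (\<integral>\<^sup>+x. ennreal (f x) \<partial>\<nu>)" .
  have "integrable \<mu> f" "integrable \<nu> f"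
    using f by (auto intro!: integrable_bounded_on[OF m(2,3)] integrable_bounded_on[OF n(2,3)] boundedI[of _ 1])
  then have "(\<integral>\<^sup>+x. ennreal (f x) \<partial>\<mu>) = ennreal (\<integral>x. f x \<partial>\<mu>)"
    "(\<integral>\<^sup>+x. ennreal (f x) \<partial>\<nu>) = ennreal (\<integral>x. f x \<partial>\<nu>)"
    using f(2) m(4) n(4) by (auto intro!: nn_integral_eq_integral)
  then have "ennreal (\<integral>x. f x \<partial>\<mu>) \<le> ennreal (1 + c) * ennreal (\<integral>x. f x \<partial>\<nu>)"
    using nn by simp
  moreover note b = prob_integral_bounds[OF \<nu> f]
  ultimately have "ennreal (\<integral>x. f x \<partial>\<mu>) \<le> ennreal ((1 + c) * (\<integral>x. f x \<partial>\<nu>))"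
    using c by (subst ennreal_mult) simp_all
  then have "(\<integral>x. f x \<partial>\<mu>) \<le> (1 + c) * (\<integral>x. f x \<partial>\<nu>)"
    using b c by (subst (asm) ennreal_le_iff) auto
  also have "\<dots> = (\<integral>x. f x \<partial>\<nu>) + c * (\<integral>x. f x \<partial>\<nu>)" by (simp add: algebra_simps)
  also have "\<dots> \<le> (\<integral>x. f x \<partial>\<nu>) + c" using b c by (simp add: mult_left_le)
  finally show ?thesis .
qed

section \<open>Oscillation under the linear kernel and the one-step perturbation\<close>

context V_kernel
begin

definition Kf :: "('a \<Rightarrow> real) \<Rightarrow> 'a \<Rightarrow> real" where
  "Kf f x = (\<integral>y. f y \<partial>K x)"

definition test_fun :: "('a \<Rightarrow> real) set" where
  "test_fun = {f \<in> borel_measurable M. \<forall>x\<in>space M. 0 \<le> f x \<and> f x \<le> 1}"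

lemma Kf_test_fun: "f \<in> test_fun \<Longrightarrow> Kf f \<in> test_fun"
  using kernel_integral_measurable[OF kernel] prob_integral_bounds[OF measurable_space[OF kernel]]
  by (auto simp: test_fun_def Kf_def[abs_def])

lemma Kf_power_test_fun: "f \<in> test_fun \<Longrightarrow> (Kf ^^ k) f \<in> test_fun"
  by (induction k) (auto intro: Kf_test_fun)

text \<open>Needed to iterate \<open>V_difference\<close>, which describes its result on the carrier
  only, while \<open>V_op\<close> acts on total functions.\<close>

lemma V_cong:
  fixes g h :: "'a \<times> 'a \<Rightarrow> real"
  assumes "g \<in> bm" "h \<in> bm" "\<And>u. u \<in> space N \<Longrightarrow> g u = h u"
  shows "V_op M K g z = V_op M K h z"
  using assms by (intro antisym V_mono) auto

lemma difference_le_1: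
  assumes "f \<in> test_fun" "z \<in> space N"
  shows "\<bar>f (fst z) - f (snd z)\<bar> \<le> 1"
proof -
  have "fst z \<in> space M" "snd z \<in> space M" using assms(2) by (auto simp: space_pair_measure)
  then have "0 \<le> f (fst z) \<and> f (fst z) \<le> 1" "0 \<le> f (snd z) \<and> f (snd z) \<le> 1"
    using assms(1) by (auto simp: test_fun_def)
  then show ?thesis by linarith
qed

lemma difference_bm:
  assumes "f \<in> test_fun" shows "(\<lambda>u. f (fst u) - f (snd u)) \<in> bm"
proof (rule bmI)
  have [measurable]: "f \<in> borel_measurable M" using assms by (simp add: test_fun_def)
  show "(\<lambda>u. f (fst u) - f (snd u)) \<in> borel_measurable N" by measurable
qed (use difference_le_1[OF assms] in auto)

text \<open>The excess parts at a pair of points differ by the difference of the two transition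
  laws. Thus \<open>V\<close> on differences of functions mirrors \<open>K\<close> on
  functions.\<close>

lemma V_difference:
  assumes "f \<in> test_fun" "z \<in> space N"
  shows "V_op M K (\<lambda>u. f (fst u) - f (snd u)) z = Kf f (fst z) - Kf f (snd z)"
proof -
  obtain x y where z: "z = (x, y)" "x \<in> space M" "y \<in> space M"
    using assms(2) by (auto simp: space_pair_measure)
  have f: "f \<in> borel_measurable M" and b: "bounded (f ` space M)"
    using assms(1) by (auto simp: test_fun_def intro!: boundedI[of _ 1])
  show ?thesis
    using V_eq[OF assms(2) difference_bm[OF assms(1)]]
    unfolding z(1) by (simp add: V_measure_difference[OF kernel z(2,3) f b] Kf_def)
qed

lemma V_power_difference:
  assumes "f \<in> test_fun" "z \<in> space N"
  shows "(V_op M K ^^ k) (\<lambda>u. f (fst u) - f (snd u)) z = (Kf ^^ k) f (fst z) - (Kf ^^ k) f (snd z)"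
  using assms(2)
proof (induction k arbitrary: z)
  case (Suc k)
  let ?g = "(Kf ^^ k) f"
  have "V_op M K ((V_op M K ^^ k) (\<lambda>u. f (fst u) - f (snd u))) z
      = V_op M K (\<lambda>u. ?g (fst u) - ?g (snd u)) z"
    using Suc.IH
    by (intro V_cong V_power_bm difference_bm Kf_power_test_fun assms(1))
  also have "\<dots> = Kf ?g (fst z) - Kf ?g (snd z)"
    by (intro V_difference Kf_power_test_fun assms Suc.prems)
  finally show ?case by simp
qed simp

lemma Kf_power_oscillation:
  assumes f: "f \<in> test_fun" and x: "x \<in> space M" and y: "y \<in> space M"
  shows "(Kf ^^ k) f x - (Kf ^^ k) f y \<le> V_growth k"
proof -
  have z: "(x, y) \<in> space N" using x y by (simp add: space_pair_measure)
  have "(Kf ^^ k) f x - (Kf ^^ k) f y = (V_op M K ^^ k) (\<lambda>u. f (fst u) - f (snd u)) (x, y)"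
    using V_power_difference[OF f z] by simp
  also have "\<dots> \<le> 1 * V_iter k (x, y)"
    using difference_le_1[OF f] by (intro V_power_le difference_bm f z) (smt (verit))
  also have "\<dots> \<le> V_growth k" using V_iter_le_growth by simp
  finally show ?thesis .
qed

lemma Kf_power_integral_diff_le:
  assumes \<mu>: "\<mu> \<in> space (prob_algebra M)" and \<nu>: "\<nu> \<in> space (prob_algebra M)"
    and f: "f \<in> test_fun"
  shows "(\<integral>x. (Kf ^^ k) f x \<partial>\<mu>) - (\<integral>x. (Kf ^^ k) f x \<partial>\<nu>) \<le> V_growth k * (tv \<mu> \<nu> / 2)"
proof (rule integral_diff_le_tv[OF \<mu> \<nu>])
  let ?g = "(Kf ^^ k) f"
  have g: "?g \<in> test_fun" by (rule Kf_power_test_fun[OF f])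
  then show "?g \<in> borel_measurable M" by (simp add: test_fun_def)
  fix x assume x: "x \<in> space M"
  \<comment> \<open>The base value \<open>b\<close> is the infimum of the iterate; the oscillation
    bound then gives \<open>c = V_growth k\<close>.\<close>
  show "(INF y\<in>space M. ?g y) \<le> ?g x"
    using g x by (intro cINF_lower bdd_belowI2[of _ 0]) (auto simp: test_fun_def)
  have "?g x - V_growth k \<le> (INF y\<in>space M. ?g y)"
    using nonempty Kf_power_oscillation[OF f x, of _ k]
    by (intro cINF_greatest) (auto simp: algebra_simps)
  then show "?g x \<le> (INF y\<in>space M. ?g y) + V_growth k" by simp
qed

lemma test_fun_integral_diff_le:
  assumes "\<mu> \<in> space (prob_algebra M)" "\<nu> \<in> space (prob_algebra M)" "f \<in> test_fun"
  shows "(\<integral>x. f x \<partial>\<mu>) - (\<integral>x. f x \<partial>\<nu>) \<le> tv \<mu> \<nu> / 2"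
  using integral_diff_le_tv[OF assms(1,2), of f 0 1] assms(3) by (simp add: test_fun_def)

text \<open>Let \<open>r\<close> and \<open>s\<close> be the integrals of \<open>f\<close> against
  \<open>R\<close> and \<open>S\<close>. The difference splits into \<open>Kf f\<close> and
  \<open>r - Kf f\<close>, both integrated against \<open>\<mu> - \<nu>\<close>, and
  \<open>r - s\<close> integrated against \<open>\<nu>\<close>. Since \<open>r - Kf f\<close> ranges
  in an interval of length \<open>2 * c\<close> and is integrated against a difference, its error is
  also proportional to \<open>tv \<mu> \<nu>\<close>; this is what allows iteration.\<close>

lemma bind_integral_diff_le:
  assumes \<mu>: "\<mu> \<in> space (prob_algebra M)" and \<nu>: "\<nu> \<in> space (prob_algebra M)"
    and R: "R \<in> M \<rightarrow>\<^sub>M prob_algebra M" and S: "S \<in> M \<rightarrow>\<^sub>M prob_algebra M"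
    and f: "f \<in> test_fun"
    and close: "\<And>x. x \<in> space M \<Longrightarrow> \<bar>(\<integral>y. f y \<partial>R x) - Kf f x\<bar> \<le> c"
    and lip: "\<And>x. x \<in> space M \<Longrightarrow> tv (R x) (S x) \<le> l * tv \<mu> \<nu>"
  shows "(\<integral>x. f x \<partial>(\<mu> \<bind> R)) - (\<integral>x. f x \<partial>(\<nu> \<bind> S))
    \<le> (\<integral>x. Kf f x \<partial>\<mu>) - (\<integral>x. Kf f x \<partial>\<nu>) + (2 * c + l) * (tv \<mu> \<nu> / 2)"
proof -
  note m = prob_algebraD[OF \<mu>] and n = prob_algebraD[OF \<nu>]
  interpret \<nu>: prob_space \<nu> by (rule n)
  have fm: "f \<in> borel_measurable M" and fb: "\<And>x. x \<in> space M \<Longrightarrow> 0 \<le> f x \<and> f x \<le> 1"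
    using f by (auto simp: test_fun_def)
  define r where "r x = (\<integral>y. f y \<partial>R x)" for x
  define s where "s x = (\<integral>y. f y \<partial>S x)" for x
  have tf: "r \<in> test_fun" "s \<in> test_fun" "Kf f \<in> test_fun"
    using kernel_integral_measurable[OF R fm] kernel_integral_measurable[OF S fm]
      prob_integral_bounds[OF measurable_space[OF R] fm fb]
      prob_integral_bounds[OF measurable_space[OF S] fm fb] Kf_test_fun[OF f]
    by (auto simp: test_fun_def r_def[abs_def] s_def[abs_def])
  have int: "integrable \<mu> g" "integrable \<nu> g" if "g \<in> test_fun" for g
    using that by (auto simp: test_fun_def intro!: integrable_bounded_on[OF m(2,3)]
      integrable_bounded_on[OF n(2,3)] boundedI[of _ 1])
  have "(\<integral>x. r x - Kf f x \<partial>\<mu>) - (\<integral>x. r x - Kf f x \<partial>\<nu>) \<le> 2 * c * (tv \<mu> \<nu> / 2)"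
  proof (rule integral_diff_le_tv[OF \<mu> \<nu>, where b = "- c"])
    show "(\<lambda>x. r x - Kf f x) \<in> borel_measurable M" using tf by (auto simp: test_fun_def)
    fix x assume "x \<in> space M"
    then show "- c \<le> r x - Kf f x" "r x - Kf f x \<le> - c + 2 * c"
      using close[of x] by (auto simp: r_def abs_le_iff)
  qed
  moreover have "(\<integral>x. r x - s x \<partial>\<nu>) \<le> l * (tv \<mu> \<nu> / 2)"
  proof (rule \<nu>.integral_le_const)
    show "integrable \<nu> (\<lambda>x. r x - s x)" using int tf by simp
    show "AE x in \<nu>. r x - s x \<le> l * (tv \<mu> \<nu> / 2)"
    proof (rule AE_I2)
      fix x assume "x \<in> space \<nu>"
      then have x: "x \<in> space M" using n by simp
      have "r x - s x \<le> tv (R x) (S x) / 2"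
        unfolding r_def s_def
        by (intro test_fun_integral_diff_le f measurable_space[OF R] measurable_space[OF S] x)
      then show "r x - s x \<le> l * (tv \<mu> \<nu> / 2)" using lip[OF x] by simp
    qed
  qed
  moreover have "(\<integral>x. f x \<partial>(\<mu> \<bind> R)) = (\<integral>x. r x \<partial>\<mu>)" "(\<integral>x. f x \<partial>(\<nu> \<bind> S)) = (\<integral>x. s x \<partial>\<nu>)"
    unfolding r_def s_def using fm fb
    by (auto intro!: integral_bind_prob[OF \<mu> R] integral_bind_prob[OF \<nu> S])
  ultimately show ?thesis
    using int tf by (simp add: algebra_simps add_divide_distrib)
qed

end

section \<open>Contraction of the marginal laws\<close>

lemma law_in_prob_algebra:
  assumes "\<And>\<mu>. \<mu> \<in> space (prob_algebra M) \<Longrightarrow> P \<mu> \<in> M \<rightarrow>\<^sub>M prob_algebra M"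
    and "\<mu> \<in> space (prob_algebra M)"
  shows "law P \<mu> n \<in> space (prob_algebra M)"
  using assms by (induction n) (auto intro: bind_in_prob_algebra)

lemma law_add: "law P \<mu> (m + n) = law P (law P \<mu> m) n"
  by (induction n) auto

text \<open>The density ratio bound enters through its consequence \<open>close\<close> on test
  functions, with \<gamma> as \<open>c\<close>; the constant \<open>l\<close> is the one-step
  Lipschitz constant.\<close>

locale nonlinear_chain = V_kernel +
  fixes P :: "'a measure \<Rightarrow> 'a \<Rightarrow> 'a measure" and c l :: real
  assumes P: "\<And>\<mu>. \<mu> \<in> space (prob_algebra M) \<Longrightarrow> P \<mu> \<in> M \<rightarrow>\<^sub>M prob_algebra M"
    and close: "\<And>\<mu> x f. \<mu> \<in> space (prob_algebra M) \<Longrightarrow> x \<in> space M \<Longrightarrow> f \<in> test_fun \<Longrightarrow>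
      \<bar>(\<integral>y. f y \<partial>P \<mu> x) - Kf f x\<bar> \<le> c"
    and lip: "\<And>\<mu> \<nu> x. \<mu> \<in> space (prob_algebra M) \<Longrightarrow> \<nu> \<in> space (prob_algebra M) \<Longrightarrow>
      x \<in> space M \<Longrightarrow> tv (P \<mu> x) (P \<nu> x) \<le> l * tv \<mu> \<nu>"
    and c_nonneg: "0 \<le> c" and l_nonneg: "0 \<le> l"
begin

lemmas law_prob = law_in_prob_algebra[OF P]

definition \<delta> where "\<delta> = 2 * c + l"

lemma \<delta>_nonneg: "0 \<le> \<delta>"
  using c_nonneg l_nonneg by (simp add: \<delta>_def)

text \<open>The last step is replaced by \<open>K\<close> and the induction hypothesis is used for
  \<open>Kf f\<close>, hence the generalisation over \<open>f\<close>. The errors add up through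
  \<open>(1 + \<delta>)^k - 1 + \<delta> * (1 + \<delta>)^k = (1 + \<delta>)^(k+1) -
  1\<close>.\<close>

lemma law_integral_diff_le:
  assumes \<mu>: "\<mu> \<in> space (prob_algebra M)" and \<nu>: "\<nu> \<in> space (prob_algebra M)"
    and f: "f \<in> test_fun"
  shows "(\<integral>x. f x \<partial>law P \<mu> k) - (\<integral>x. f x \<partial>law P \<nu> k)
    \<le> (\<integral>x. (Kf ^^ k) f x \<partial>\<mu>) - (\<integral>x. (Kf ^^ k) f x \<partial>\<nu>) + ((1 + \<delta>) ^ k - 1) * (tv \<mu> \<nu> / 2)"
  using f
proof (induction k arbitrary: f)
  case (Suc k)
  let ?\<mu> = "law P \<mu> k" and ?\<nu> = "law P \<nu> k"
  have pr: "?\<mu> \<in> space (prob_algebra M)" "?\<nu> \<in> space (prob_algebra M)"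
    using \<mu> \<nu> by (auto intro: law_prob)
  \<comment> \<open>A crude bound on the current distance: the iterate of \<open>g\<close> under
    \<open>K\<close> is again a test function, so the induction hypothesis gives the factor
    \<open>1 + ((1 + \<delta>)^k - 1)\<close>.\<close>
  have "tv ?\<mu> ?\<nu> \<le> 2 * ((1 + \<delta>) ^ k * (tv \<mu> \<nu> / 2))"
  proof (rule tv_leI[OF pr])
    fix g :: "'a \<Rightarrow> real"
    assume "g \<in> borel_measurable M" "\<And>x. x \<in> space M \<Longrightarrow> 0 \<le> g x \<and> g x \<le> 1"
    then have g: "g \<in> test_fun" by (simp add: test_fun_def)
    show "(\<integral>x. g x \<partial>?\<mu>) - (\<integral>x. g x \<partial>?\<nu>) \<le> (1 + \<delta>) ^ k * (tv \<mu> \<nu> / 2)"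
      using Suc.IH[OF g] test_fun_integral_diff_le[OF \<mu> \<nu> Kf_power_test_fun[OF g], of k]
      by (simp add: algebra_simps)
  qed
  then have "\<delta> * (tv ?\<mu> ?\<nu> / 2) \<le> \<delta> * ((1 + \<delta>) ^ k * (tv \<mu> \<nu> / 2))"
    using \<delta>_nonneg by (intro mult_left_mono) auto
  moreover have "(\<integral>x. f x \<partial>law P \<mu> (Suc k)) - (\<integral>x. f x \<partial>law P \<nu> (Suc k))
      \<le> (\<integral>x. Kf f x \<partial>?\<mu>) - (\<integral>x. Kf f x \<partial>?\<nu>) + \<delta> * (tv ?\<mu> ?\<nu> / 2)"
    unfolding law.simps \<delta>_def by (intro bind_integral_diff_le pr P Suc.prems close lip)
  moreover have "(\<integral>x. Kf f x \<partial>?\<mu>) - (\<integral>x. Kf f x \<partial>?\<nu>)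
    \<le> (\<integral>x. (Kf ^^ Suc k) f x \<partial>\<mu>) - (\<integral>x. (Kf ^^ Suc k) f x \<partial>\<nu>) + ((1 + \<delta>) ^ k - 1) * (tv \<mu> \<nu> / 2)"
    using Suc.IH[OF Kf_test_fun[OF Suc.prems]] by (simp add: funpow_swap1)
  ultimately show ?case by (simp add: algebra_simps add_divide_distrib)
qed simp

lemma tv_law_le:
  assumes \<mu>: "\<mu> \<in> space (prob_algebra M)" and \<nu>: "\<nu> \<in> space (prob_algebra M)"
  shows "tv (law P \<mu> k) (law P \<nu> k) \<le> (V_growth k + (1 + \<delta>) ^ k - 1) * tv \<mu> \<nu>"
proof -
  have "tv (law P \<mu> k) (law P \<nu> k) \<le> 2 * ((V_growth k + (1 + \<delta>) ^ k - 1) * (tv \<mu> \<nu> / 2))"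
  proof (rule tv_leI[OF law_prob[OF _ \<mu>] law_prob[OF _ \<nu>]])
    fix f :: "'a \<Rightarrow> real"
    assume "f \<in> borel_measurable M" "\<And>x. x \<in> space M \<Longrightarrow> 0 \<le> f x \<and> f x \<le> 1"
    then have f: "f \<in> test_fun" by (simp add: test_fun_def)
    show "(\<integral>x. f x \<partial>law P \<mu> k) - (\<integral>x. f x \<partial>law P \<nu> k) \<le> (V_growth k + (1 + \<delta>) ^ k - 1) * (tv \<mu> \<nu> / 2)"
      using law_integral_diff_le[OF \<mu> \<nu> f, of k] Kf_power_integral_diff_le[OF \<mu> \<nu> f, of k]
      by (simp add: algebra_simps add_divide_distrib diff_divide_distrib)
  qed auto
  then show ?thesis by simp
qed

text \<open>The block estimate holds for arbitrary initial laws, so the chains can be restarted from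
  their current laws after every \<open>k\<close> steps.\<close>

lemma tv_law_mult_le:
  assumes \<mu>: "\<mu> \<in> space (prob_algebra M)" and \<nu>: "\<nu> \<in> space (prob_algebra M)"
    and q: "V_growth k + (1 + \<delta>) ^ k - 1 \<le> q"
  shows "tv (law P \<mu> (k * n)) (law P \<nu> (k * n)) \<le> q ^ n * tv \<mu> \<nu>"
proof (induction n)
  case (Suc n)
  have pr: "law P \<mu> (k * n) \<in> space (prob_algebra M)" "law P \<nu> (k * n) \<in> space (prob_algebra M)"
    using \<mu> \<nu> by (auto intro: law_prob)
  have "1 \<le> (1 + \<delta>) ^ k" using \<delta>_nonneg by simp
  then have q0: "0 \<le> q" using q V_growth_nonneg[of k] by linarith
  have "tv (law P \<mu> (k * Suc n)) (law P \<nu> (k * Suc n))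
      = tv (law P (law P \<mu> (k * n)) k) (law P (law P \<nu> (k * n)) k)"
    by (simp add: add.commute[of k] law_add)
  also have "\<dots> \<le> (V_growth k + (1 + \<delta>) ^ k - 1) * tv (law P \<mu> (k * n)) (law P \<nu> (k * n))"
    by (rule tv_law_le[OF pr])
  also have "\<dots> \<le> q * tv (law P \<mu> (k * n)) (law P \<nu> (k * n))"
    by (intro mult_right_mono q tv_nonneg[OF pr])
  also have "\<dots> \<le> q * (q ^ n * tv \<mu> \<nu>)"
    by (intro mult_left_mono Suc.IH q0)
  finally show ?case by (simp add: mult.assoc)
qed simp

lemma limsup_tv_law_le:
  assumes \<mu>: "\<mu> \<in> space (prob_algebra M)" and \<nu>: "\<nu> \<in> space (prob_algebra M)"
    and k: "1 \<le> k" and t: "0 < t" and q: "V_growth k + (1 + \<delta>) ^ k - 1 \<le> t ^ k"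
  shows "limsup (\<lambda>n. ereal (1 / real n) * eln (tv (law P \<mu> n) (law P \<nu> n))) \<le> ereal (ln t)"
proof -
  \<comment> \<open>The 2 bounds every distance, and the power dominates
    \<open>(1 / t) ^ (n mod k)\<close> whether \<open>t\<close> is below or above 1.\<close>
  define B where "B = 2 * max 1 (1 / t) ^ k"
  have B: "0 < B" by (simp add: B_def)
  have bound: "tv (law P \<mu> n) (law P \<nu> n) \<le> B * t ^ n" for n
  proof -
    let ?i = "n mod k"
    \<comment> \<open>The \<open>n mod k\<close> surplus steps are run first; the laws reached serve
      as initial laws for the full blocks.\<close>
    have n: "n = ?i + k * (n div k)" by simp
    have pr: "law P \<mu> ?i \<in> space (prob_algebra M)" "law P \<nu> ?i \<in> space (prob_algebra M)"
      using \<mu> \<nu> by (auto intro: law_prob)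
    have "tv (law P \<mu> n) (law P \<nu> n)
        = tv (law P (law P \<mu> ?i) (k * (n div k))) (law P (law P \<nu> ?i) (k * (n div k)))"
      by (subst (1 2) n) (simp only: law_add)
    also have "\<dots> \<le> (t ^ k) ^ (n div k) * tv (law P \<mu> ?i) (law P \<nu> ?i)"
      by (rule tv_law_mult_le[OF pr q])
    also have "\<dots> \<le> (t ^ k) ^ (n div k) * 2"
      using t by (intro mult_left_mono tv_le_2[OF pr]) auto
    also have "(t ^ k) ^ (n div k) = t ^ n * (1 / t) ^ ?i"
    proof -
      have "t ^ n = t ^ ?i * (t ^ k) ^ (n div k)"
        by (subst n) (simp only: power_add power_mult)
      then show ?thesis using t by (simp add: power_one_over)
    qed
    also have "(1 / t) ^ ?i \<le> max 1 (1 / t) ^ k"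
    proof -
      have "(1 / t) ^ ?i \<le> max 1 (1 / t) ^ ?i" using t by (intro power_mono) auto
      also have "\<dots> \<le> max 1 (1 / t) ^ k" using k by (intro power_increasing) auto
      finally show ?thesis .
    qed
    finally show ?thesis using t by (simp add: B_def mult.commute mult.left_commute)
  qed
  have "limsup (\<lambda>n. ereal (1 / real n) * eln (tv (law P \<mu> n) (law P \<nu> n)))
      \<le> limsup (\<lambda>n. ereal (ln B / real n + ln t))"
  \<comment> \<open>For \<open>n \<ge> 1\<close> the factor \<open>1 / n\<close> is positive, so a
    vanishing distance gives minus infinity; at \<open>n = 0\<close> the product would be 0.\<close>
  proof (rule Limsup_mono, rule eventually_sequentiallyI[of 1])
    fix n :: nat assume n: "1 \<le> n"
    let ?x = "tv (law P \<mu> n) (law P \<nu> n)"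
    show "ereal (1 / real n) * eln ?x \<le> ereal (ln B / real n + ln t)"
    proof (cases "?x \<le> 0")
      case False
      then have "ln ?x \<le> ln (B * t ^ n)" using bound[of n] B t by (subst ln_le_cancel_iff) auto
      also have "\<dots> = ln B + n * ln t" using B t by (simp add: ln_mult ln_realpow)
      finally have "ln ?x / n \<le> (ln B + n * ln t) / n" by (simp add: divide_right_mono)
      then show ?thesis using False n by (simp add: eln_def add_divide_distrib)
    qed (use n in \<open>simp add: eln_def\<close>)
  qed
  also have "(\<lambda>n. ln B / real n + ln t) \<longlonglongrightarrow> 0 + ln t"
    by (intro tendsto_intros lim_const_over_n)
  then have "limsup (\<lambda>n. ereal (ln B / real n + ln t)) = ereal (ln t)"
    by (intro lim_imp_Limsup) auto
  finally show ?thesis .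
qed

end

section \<open>The limit along a sequence of kernel families\<close>

theorem corollary1:
  fixes M :: "'a measure"
    and Pbar :: "'a \<Rightarrow> 'a measure"
    and P :: "nat \<Rightarrow> 'a measure \<Rightarrow> 'a \<Rightarrow> 'a measure"
    and \<gamma> :: "nat \<Rightarrow> real"
    and lam :: "nat \<Rightarrow> nat \<Rightarrow> real"
    and \<mu>0 \<nu>0 :: "'a measure"
  assumes Pbar: "Pbar \<in> M \<rightarrow>\<^sub>M prob_algebra M"
    and V_measurable: "\<And>h :: 'a \<times> 'a \<Rightarrow> real. h \<in> borel_measurable (M \<Otimes>\<^sub>M M) \<Longrightarrow>
      bounded (h ` space (M \<Otimes>\<^sub>M M)) \<Longrightarrow> V_op M Pbar h \<in> borel_measurable (M \<Otimes>\<^sub>M M)"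
    and P: "\<And>j \<mu>. \<mu> \<in> space (prob_algebra M) \<Longrightarrow> P j \<mu> \<in> M \<rightarrow>\<^sub>M prob_algebra M"
    and \<gamma>_pos: "\<And>j. \<gamma> j > 0"
    and ac1: "\<And>j \<mu> x. \<mu> \<in> space (prob_algebra M) \<Longrightarrow> x \<in> space M \<Longrightarrow>
      absolutely_continuous (P j \<mu> x) (Pbar x)"
    and ac2: "\<And>j \<mu> x. \<mu> \<in> space (prob_algebra M) \<Longrightarrow> x \<in> space M \<Longrightarrow>
      absolutely_continuous (Pbar x) (P j \<mu> x)"
    and ratio: "\<And>j \<mu> x. \<mu> \<in> space (prob_algebra M) \<Longrightarrow> x \<in> space M \<Longrightarrow>
      AE y in P j \<mu> x. RN_deriv (P j \<mu> x) (Pbar x) y \<le> ennreal (1 + \<gamma> j)"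
    and lipschitz: "\<And>j k \<mu> \<nu> x. k \<ge> 1 \<Longrightarrow> \<mu> \<in> space (prob_algebra M) \<Longrightarrow>
      \<nu> \<in> space (prob_algebra M) \<Longrightarrow> x \<in> space M \<Longrightarrow>
      tv (kernel_step M (P j) k \<mu> x) (kernel_step M (P j) k \<nu> x) \<le> lam j k * tv \<mu> \<nu>"
    and \<gamma>_lim: "\<gamma> \<longlonglongrightarrow> 0"
    and lam_lim: "(\<lambda>j. lam j 1) \<longlonglongrightarrow> 0"
    and \<mu>0: "\<mu>0 \<in> space (prob_algebra M)"
    and \<nu>0: "\<nu>0 \<in> space (prob_algebra M)"
  shows "limsup (\<lambda>j. limsup (\<lambda>n. ereal (1 / real n) * eln (tv (law (P j) \<mu>0 n) (law (P j) \<nu>0 n))))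
    \<le> eln (spectral_radius (M \<Otimes>\<^sub>M M) (V_op M Pbar))"
proof -
  interpret V: V_kernel M Pbar
  proof
    show "space M \<noteq> {}"
      using prob_algebraD[OF \<mu>0] prob_space.not_empty by metis
  qed (fact Pbar V_measurable)+
  \<comment> \<open>The sign of \<open>lam j 1\<close> is not prescribed; its absolute value is
    nonnegative, is still a Lipschitz constant, and tends to 0 as well.\<close>
  have chain: "nonlinear_chain M Pbar (P j) (\<gamma> j) \<bar>lam j 1\<bar>" for j
  proof
    fix \<mu> \<nu> x assume \<mu>: "\<mu> \<in> space (prob_algebra M)" and x: "x \<in> space M"
    have p: "P j \<mu> x \<in> space (prob_algebra M)" "Pbar x \<in> space (prob_algebra M)"
      using measurable_space[OF P[OF \<mu>] x] measurable_space[OF Pbar x] by auto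
    have upper: "V.Kf f x \<le> (\<integral>y. f y \<partial>P j \<mu> x) + \<gamma> j" if "f \<in> V.test_fun" for f
      unfolding V.Kf_def using that \<gamma>_pos[of j]
      by (intro RN_deriv_le_integral_le[OF p(2,1) ac1[OF \<mu> x] ratio[OF \<mu> x]])
         (auto simp: V.test_fun_def)
    show "\<bar>(\<integral>y. f y \<partial>P j \<mu> x) - V.Kf f x\<bar> \<le> \<gamma> j" if f: "f \<in> V.test_fun" for f
    proof -
      interpret p: prob_space "P j \<mu> x" by (rule prob_algebraD(1)[OF p(1)])
      interpret q: prob_space "Pbar x" by (rule prob_algebraD(1)[OF p(2)])
      have "integrable (P j \<mu> x) f" "integrable (Pbar x) f"
        using f by (auto simp: V.test_fun_def prob_algebraD[OF p(1)] prob_algebraD[OF p(2)]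
          intro!: integrable_bounded_on[of _ M] boundedI[of _ 1])
      moreover have "(\<lambda>y. 1 - f y) \<in> V.test_fun" using f by (auto simp: V.test_fun_def)
      ultimately show ?thesis
        using upper[OF f] upper[of "\<lambda>y. 1 - f y"]
        by (simp add: V.Kf_def p.prob_space q.prob_space abs_le_iff)
    qed
    assume \<nu>: "\<nu> \<in> space (prob_algebra M)"
    have step: "kernel_step M (P j) 1 \<mu> x = P j \<mu> x" if "\<mu> \<in> space (prob_algebra M)" for \<mu>
      using bind_return[OF measurable_prob_algebraD[OF P[OF that]] x] by simp
    have "tv (P j \<mu> x) (P j \<nu> x) \<le> lam j 1 * tv \<mu> \<nu>"
      using lipschitz[OF order_refl \<mu> \<nu> x, of j] by (simp only: step \<mu> \<nu>)
    also have "\<dots> \<le> \<bar>lam j 1\<bar> * tv \<mu> \<nu>"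
      using tv_nonneg[OF \<mu> \<nu>] by (intro mult_right_mono) auto
    finally show "tv (P j \<mu> x) (P j \<nu> x) \<le> \<bar>lam j 1\<bar> * tv \<mu> \<nu>" .
  qed (use P \<gamma>_pos in \<open>auto simp: less_imp_le\<close>)
  let ?L = "limsup (\<lambda>j. limsup (\<lambda>n. ereal (1 / real n) * eln (tv (law (P j) \<mu>0 n) (law (P j) \<nu>0 n))))"
  let ?r = "spectral_radius (M \<Otimes>\<^sub>M M) (V_op M Pbar)"
  show ?thesis
  proof (rule ccontr)
    assume "\<not> ?thesis"
    \<comment> \<open>A real \<open>z\<close> strictly between the two sides: \<open>exp z\<close>
      exceeds the spectral radius, including the case where \<open>eln\<close> of it is minus
      infinity.\<close>
    then obtain z where z: "eln ?r < ereal z" "ereal z < ?L"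
      using ereal_dense2[of "eln ?r" ?L] by (auto simp: not_le)
    have "?r < exp z"
    proof (cases "?r \<le> 0")
      case False
      then have "ln ?r < z" using z(1) by (simp add: eln_def)
      then have "exp (ln ?r) < exp z" by (simp only: exp_less_cancel_iff)
      then show ?thesis using False by (simp only: not_le exp_ln)
    qed (use exp_gt_zero[of z] in linarith)
    \<comment> \<open>This \<open>k\<close> depends on \<open>z\<close> and \<open>Pbar\<close> but
      not on \<open>j\<close>. With \<open>k\<close> fixed, the perturbation
      \<open>(1 + \<delta>)^k - 1\<close> tends to 0 along \<open>j\<close>, and the strict
      inequality leaves room for it.\<close>
    then obtain k where k: "1 \<le> k" "V.V_growth k < exp z ^ k"
      using V.power_bound_of_spectral_radius[of "exp z"] by auto
    have "(\<lambda>j. V.V_growth k + (1 + (2 * \<gamma> j + \<bar>lam j 1\<bar>)) ^ k - 1) \<longlonglongrightarrow> V.V_growth k + (1 + (2 * 0 + \<bar>0\<bar>)) ^ k - 1"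
      by (intro tendsto_intros \<gamma>_lim lam_lim)
    then have "eventually (\<lambda>j. V.V_growth k + (1 + (2 * \<gamma> j + \<bar>lam j 1\<bar>)) ^ k - 1 < exp z ^ k) sequentially"
      using k by (intro order_tendstoD) auto
    then have "?L \<le> ereal z"
    proof (intro Limsup_bounded, eventually_elim)
      case (elim j)
      interpret nonlinear_chain M Pbar "P j" "\<gamma> j" "\<bar>lam j 1\<bar>" by (rule chain)
      have "V.V_growth k + (1 + \<delta>) ^ k - 1 \<le> exp z ^ k"
        using elim by (simp only: \<delta>_def less_imp_le)
      then show ?case
        using limsup_tv_law_le[OF \<mu>0 \<nu>0 k(1) exp_gt_zero] by simp
    qed
    then show False using z(2) by simp
  qed
qed

end
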